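(* There is a constant $C$ such that the heat kernel at the origin of $Q^n$ is given by $$P(y,w,t)=\frac{C}{t^{2n+3}}\int_{\mathbb R^3}e^{-f(y,w,\tau)/t}\,V(\tau)\,d\tau,\qquad (y,w)\in Q^n,\ t>0,$$ where $$f(y,w,\tau)=-i\sum_{m=1}^3\tau_mw_m+\sum_{l=1}^{n}\frac{|y_l|^2}{4}|\tau|_l\coth(|\tau|_l),\qquad V(\tau)=\prod_{l=1}^{n}\frac{|\tau|_l^{2}}{\sinh^{2}(|\tau|_l)} .$$
   Context: Fix $n\ge 1$ and real constants $a_{ml}>0$ ($m=1,2,3$, $l=1,\dots,n$). Let $$\mathcal M_1=\begin{pmatrix}0&1&0&0\\-1&0&0&0\\0&0&0&1\\0&0&-1&0\end{pmatrix},\quad \mathcal M_2=\begin{pmatrix}0&0&0&-1\\0&0&-1&0\\0&1&0&0\\1&0&0&0\end{pmatrix},\quad \mathcal M_3=\begin{pmatrix}0&0&-1&0\\0&0&0&1\\1&0&0&0\\0&-1&0&0\end{pmatrix},$$ and let $\mathbf M_m$ be the $4n\times 4n$ block diagonal matrix with diagonal blocks $a_{m1}\mathcal M_m,\dots,a_{mn}\mathcal M_m$. The group $Q^n$ is $\mathbb R^{4n}\times\mathbb R^3$ with points $(y,w)$, $y=(y_1,\dots,y_n)$, $y_l=(y_{1l},\dots,y_{4l})\in\mathbb R^4$, $w\in\mathbb R^3$, and law $(y,w)\circ(y',w')=\big(y+y',(w_m+w'_m+\frac12(\mathbf M_my,y'))_m\big)$. The left invariant horizontal fields are $$Y_{kl}=\frac{\partial}{\partial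 y_{kl}}+\frac12\sum_{m=1}^3(\mathbf M_my)_{kl}\frac{\partial}{\partial w_m},$$ and $\Delta_0=\sum_{l=1}^n\sum_{k=1}^4Y_{kl}^2$. For $\tau\in\mathbb R^3$, $|\tau|_l=\big(\sum_{m=1}^3a_{ml}^2\tau_m^2\big)^{1/2}$ (with $s\coth s$ and $s/\sinh s$ equal to $1$ at $s=0$). The heat kernel at the origin is the function $P(y,w,t)$ on $Q^n\times(0,\infty)$ with $\Delta_0P-\partial P/\partial t=0$ for $t>0$ and $\lim_{t\to0^+}P(y,w,t)=\delta(y)\delta(w)$ in the sense of distributions. *)

theory Defs
  imports "HOL-Analysis.Analysis"
begin

text \<open>
  \<^typ>\<open>real^4^'n\<close> is \<open>\<real>\<^sup>4\<^sup>n\<close> in block form: \<open>y $ l\<close> is the block \<open>y\<^sub>l\<close> in \<open>\<real>\<^sup>4\<close> and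
  \<open>y $ l $ k\<close> is the coordinate \<open>y\<^sub>k\<^sub>l\<close>; the number \<open>n \<ge> 1\<close> of blocks is \<open>CARD('n)\<close>.
\<close>

type_synonym 'n quat = "(real^4^'n) \<times> (real^3)"

definition calM :: "3 \<Rightarrow> real^4^4" where
  "calM m =
    (if m = 1 then
       vector [vector [ 0, 1, 0, 0],
               vector [-1, 0, 0, 0],
               vector [ 0, 0, 0, 1],
               vector [ 0, 0,-1, 0]]
     else if m = 2 then
       vector [vector [ 0, 0, 0,-1],
               vector [ 0, 0,-1, 0],
               vector [ 0, 1, 0, 0],
               vector [ 1, 0, 0, 0]]
     else
       vector [vector [ 0, 0,-1, 0],
               vector [ 0, 0, 0, 1],
               vector [ 1, 0, 0, 0],
               vector [ 0,-1, 0, 0]])"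

text \<open>The block diagonal matrix with blocks \<open>a m l \<cdot> calM m\<close>, as a linear map.\<close>

definition blockM :: "(3 \<Rightarrow> 'n \<Rightarrow> real) \<Rightarrow> 3 \<Rightarrow> real^4^'n \<Rightarrow> real^4^'n" where
  "blockM a m y = (\<chi> l. (a m l *\<^sub>R calM m) *v (y $ l))"

definition qmult :: "(3 \<Rightarrow> 'n::finite \<Rightarrow> real) \<Rightarrow> 'n quat \<Rightarrow> 'n quat \<Rightarrow> 'n quat" where
  "qmult a p p' = (fst p + fst p',
     \<chi> m. snd p $ m + snd p' $ m + 1/2 * (blockM a m (fst p) \<bullet> fst p'))"

definition dY :: "'n::finite \<Rightarrow> 4 \<Rightarrow> ('n quat \<Rightarrow> complex) \<Rightarrow> 'n quat \<Rightarrow> complex" where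
  "dY l k F p = frechet_derivative F (at p) (axis l (axis k 1), 0)"

definition dW :: "3 \<Rightarrow> ('n::finite quat \<Rightarrow> complex) \<Rightarrow> 'n quat \<Rightarrow> complex" where
  "dW m F p = frechet_derivative F (at p) (0, axis m 1)"

definition horizontal_field ::
  "(3 \<Rightarrow> 'n::finite \<Rightarrow> real) \<Rightarrow> 4 \<Rightarrow> 'n \<Rightarrow> ('n quat \<Rightarrow> complex) \<Rightarrow> 'n quat \<Rightarrow> complex" where
  "horizontal_field a k l F p =
     dY l k F p + 1/2 * (\<Sum>m\<in>UNIV. of_real (blockM a m (fst p) $ l $ k) * dW m F p)"

definition sublaplacian ::
  "(3 \<Rightarrow> 'n::finite \<Rightarrow> real) \<Rightarrow> ('n quat \<Rightarrow> complex) \<Rightarrow> 'n quat \<Rightarrow> complex" where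
  "sublaplacian a F p =
     (\<Sum>l\<in>UNIV. \<Sum>k\<in>UNIV. horizontal_field a k l (horizontal_field a k l F) p)"

text \<open>\<open>C\<^sup>k\<close> regularity; intended for open sets \<open>S\<close> only.\<close>

primrec Ck_on ::
  "nat \<Rightarrow> ('a::real_normed_vector \<Rightarrow> 'b::real_normed_vector) \<Rightarrow> 'a set \<Rightarrow> bool" where
  "Ck_on 0 f S \<longleftrightarrow> continuous_on S f"
| "Ck_on (Suc k) f S \<longleftrightarrow>
     (\<forall>x\<in>S. f differentiable at x) \<and> (\<forall>v. Ck_on k (\<lambda>x. frechet_derivative f (at x) v) S)"

definition test_function :: "('a::real_normed_vector \<Rightarrow> complex) \<Rightarrow> bool" where
  "test_function \<phi> \<longleftrightarrow> (\<forall>k. Ck_on k \<phi> UNIV) \<and> compact (closure {x. \<phi> x \<noteq> 0})"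

text \<open>
  A heat kernel at the origin is a classical solution of the heat equation for \<open>t > 0\<close>
  (the \<open>C\<^sup>2\<close> condition makes all derivatives in the equation genuine) with initial value
  the delta distribution at the origin. Values at \<open>t \<le> 0\<close> are irrelevant.
\<close>

definition heat_kernel ::
  "(3 \<Rightarrow> 'n::finite \<Rightarrow> real) \<Rightarrow> ('n quat \<Rightarrow> real \<Rightarrow> complex) \<Rightarrow> bool" where
  "heat_kernel a P \<longleftrightarrow>
     Ck_on 2 (\<lambda>(p, t). P p t) (UNIV \<times> {0<..}) \<and>
     (\<forall>p. \<forall>t>0. sublaplacian a (\<lambda>q. P q t) p - vector_derivative (P p) (at t) = 0) \<and>
     (\<forall>\<phi>. test_function \<phi> \<longrightarrow>
        ((\<lambda>t. LINT p|lborel. P p t * \<phi> p) \<longlongrightarrow> \<phi> (0, 0)) (at_right 0))"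

definition tau_norm :: "(3 \<Rightarrow> 'n \<Rightarrow> real) \<Rightarrow> 'n \<Rightarrow> real^3 \<Rightarrow> real" where
  "tau_norm a l \<tau> = sqrt (\<Sum>m\<in>UNIV. (a m l)\<^sup>2 * (\<tau> $ m)\<^sup>2)"

definition s_coth :: "real \<Rightarrow> real" where
  "s_coth s = (if s = 0 then 1 else s * (cosh s / sinh s))"

definition s_over_sinh :: "real \<Rightarrow> real" where
  "s_over_sinh s = (if s = 0 then 1 else s / sinh s)"

definition phase ::
  "(3 \<Rightarrow> 'n::finite \<Rightarrow> real) \<Rightarrow> real^4^'n \<Rightarrow> real^3 \<Rightarrow> real^3 \<Rightarrow> complex" where
  "phase a y w \<tau> =
     - \<i> * of_real (\<Sum>m\<in>UNIV. \<tau> $ m * w $ m)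
     + of_real (\<Sum>l\<in>UNIV. (norm (y $ l))\<^sup>2 / 4 * s_coth (tau_norm a l \<tau>))"

definition volume_factor :: "(3 \<Rightarrow> 'n::finite \<Rightarrow> real) \<Rightarrow> real^3 \<Rightarrow> real" where
  "volume_factor a \<tau> = (\<Prod>l\<in>UNIV. (s_over_sinh (tau_norm a l \<tau>))\<^sup>2)"

text \<open>
  The fields are the left invariant ones of the group law: \<^const>\<open>horizontal_field\<close> differentiates
  along right translation by the curve with initial velocity \<open>\<partial>/\<partial>y\<^sub>k\<^sub>l\<close>.
\<close>

lemma horizontal_field_left_invariant:
  assumes "F differentiable at p"
  shows "((\<lambda>s. F (qmult a p (s *\<^sub>R axis l (axis k 1), 0)))
           has_vector_derivative horizontal_field a k l F p) (at 0)"
proof -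
  let ?e = "axis l (axis k 1) :: real^4^'a"
  define b :: "real^3" where "b = (\<chi> m. 1/2 * (blockM a m (fst p) $ l $ k))"
  have c: "qmult a p (s *\<^sub>R ?e, 0) = p + s *\<^sub>R (?e, b)" for s
    by (cases p) (auto simp: qmult_def b_def vec_eq_iff inner_axis)
  let ?D = "frechet_derivative F (at p)"
  have D: "(F has_derivative ?D) (at p)"
    using assms frechet_derivative_works by blast
  then interpret D: bounded_linear ?D by (rule has_derivative_bounded_linear)
  have "((\<lambda>s. p + s *\<^sub>R (?e, b)) has_derivative (\<lambda>s. s *\<^sub>R (?e, b))) (at 0)"
    by (auto intro!: derivative_eq_intros)
  moreover have "(F has_derivative ?D) (at (p + 0 *\<^sub>R (?e, b)))"
    using D by (simp only: scaleR_zero_left add_0_right)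
  ultimately have "((\<lambda>s. F (p + s *\<^sub>R (?e, b))) has_derivative (\<lambda>s. ?D (s *\<^sub>R (?e, b)))) (at 0)"
    by (rule has_derivative_compose)
  moreover have "?D (?e, b) = horizontal_field a k l F p"
  proof -
    have "b = (\<Sum>m\<in>UNIV. (b $ m) *\<^sub>R axis m 1)"
      using basis_expansion[of b] by (simp add: scalar_mult_eq_scaleR)
    then have "(?e, b) = (?e, 0) + (\<Sum>m\<in>UNIV. (b $ m) *\<^sub>R (0, axis m 1))"
      by (auto intro!: prod_eqI simp: fst_sum snd_sum)
    then have "?D (?e, b) = ?D (?e, 0) + (\<Sum>m\<in>UNIV. (b $ m) *\<^sub>R ?D (0, axis m 1))"
      by (simp only: D.add D.sum D.scaleR)
    then show ?thesis
      by (simp add: horizontal_field_def dY_def dW_def b_def scaleR_conv_of_real sum_distrib_left)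
  qed
  ultimately show ?thesis
    unfolding c has_vector_derivative_def by (simp only: D.scaleR)
qed

end

theory Submission
  imports Defs "HOL-Probability.Probability"
begin

text \<open>
  A Fourier transform in the central variable \<open>w\<close> turns \<open>\<Delta>\<^sub>0\<close> into harmonic oscillators. On a
  function \<open>u(y) e\<^bsup>is\<cdot>w\<^esup>\<close> the field \<open>Y\<^sub>k\<^sub>l\<close> acts as
  \<open>\<partial>/\<partial>y\<^sub>k\<^sub>l + (i/2) \<Sum>\<^sub>m s\<^sub>m (M\<^sub>m y)\<^sub>k\<^sub>l\<close>. The blocks of the \<open>M\<^sub>m\<close> are skew and anticommute, so
  \<open>\<Sum>\<^sub>m s\<^sub>m M\<^sub>m y\<close> is orthogonal to \<open>y\<close> in each block and has norm \<open>r\<^sub>l |y\<^sub>l|\<close> there, where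
  \<open>r\<^sub>l = (\<Sum>\<^sub>m a\<^sub>m\<^sub>l\<^sup>2 s\<^sub>m\<^sup>2)\<^bsup>1/2\<^esup>\<close>. On functions of the norms \<open>|y\<^sub>l|\<close> the first order terms therefore
  vanish, and block \<open>l\<close> contributes the oscillator \<open>\<Delta> - r\<^sub>l\<^sup>2 |y\<^sub>l|\<^sup>2 / 4\<close> on \<open>\<real>\<^sup>4\<close>. Its heat kernel at
  the origin is given by the formula of Mehler: up to the factor \<open>(4\<pi>)\<^bsup>-2\<^esup>\<close> it is
  \<open>A\<^sup>2 exp (- |y\<^sub>l|\<^sup>2 B / 4)\<close> with \<open>A = r\<^sub>l / sinh (r\<^sub>l t)\<close> and \<open>B = r\<^sub>l coth (r\<^sub>l t)\<close>. The candidate is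
  thus the constant \<open>C = (2\<pi>)\<^bsup>-3\<^esup> (4\<pi>)\<^bsup>-2n\<^esup>\<close> times the integral over \<open>s\<close> of the modes
  \<open>e\<^bsup>is\<cdot>w\<^esup> \<Prod>\<^sub>l A\<^sup>2 exp (- |y\<^sub>l|\<^sup>2 B / 4)\<close>, and the substitution \<open>\<tau> = t s\<close> brings it into the required
  form (\<open>kernel_formula\<close>).

  The heat equation rests on \<open>A' = - A B\<close>, \<open>B' = - A\<^sup>2\<close> and \<open>B\<^sup>2 = r\<^sup>2 + A\<^sup>2\<close>. By the first two
  identities a derivative multiplies a mode by an expression that grows polynomially in \<open>s\<close>, while
  the mode itself decays exponentially in \<open>s\<close>, locally uniformly in \<open>t > 0\<close>. Hence the integral may
  be differentiated under the integral sign as often as desired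
  (\<open>integral_mode_has_derivative\<close>), and by the third identity the two sides of the equation
  agree mode by mode (\<open>sum_hsymbol_sq\<close>).

  For the initial value (\<open>kernel_initial_value\<close>) a test function \<open>\<phi>\<close> is paired with the
  kernel by integrating over \<open>w\<close> first, which produces the partial Fourier transform of \<open>\<phi>\<close>; it
  decays rapidly in \<open>s\<close>, uniformly in \<open>y\<close> (\<open>partial_fourier_decay\<close>). The parabolic
  scaling \<open>y = \<surd>t u\<close> turns the remaining Gaussian factor into a function that is bounded by
  \<open>exp (- |u|\<^sup>2 / 4)\<close> and tends to it as \<open>t \<rightarrow> 0\<close>. Dominated convergence leaves \<open>(4\<pi>)\<^bsup>2n\<^esup>\<close> times the
  integral of the Fourier transform of \<open>\<phi>(0, \<cdot>)\<close>, which is \<open>(4\<pi>)\<^bsup>2n\<^esup> (2\<pi>)\<^sup>3 \<phi>(0, 0)\<close> by Fourier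
  inversion (\<open>fourier_inversion_at_0\<close>).
\<close>

section \<open>Integrals depending on a parameter\<close>

text \<open>
  Dominated convergence along a filter at a point follows from the sequential version, because
  the filter is determined by the sequences that converge to the point.
\<close>

lemma dominated_convergence_filter:
  fixes f :: "'x::first_countable_topology \<Rightarrow> 's \<Rightarrow> 'b::{banach, second_countable_topology}"
  assumes w: "integrable M w"
    and g: "g \<in> borel_measurable M"
    and f: "\<forall>\<^sub>F x in at x0 within S. f x \<in> borel_measurable M"
    and bnd: "\<forall>\<^sub>F x in at x0 within S. AE s in M. norm (f x s) \<le> w s"
    and lim: "AE s in M. ((\<lambda>x. f x s) \<longlongrightarrow> g s) (at x0 within S)"
  shows "((\<lambda>x. integral\<^sup>L M (f x)) \<longlongrightarrow> integral\<^sup>L M g) (at x0 within S)"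
  unfolding tendsto_at_iff_sequentially comp_def
proof (intro allI impI)
  fix X :: "nat \<Rightarrow> 'x" assume XS: "\<forall>i. X i \<in> S - {x0}" and X: "X \<longlonglongrightarrow> x0"
  have fl: "filterlim X (at x0 within S) sequentially"
    using XS X by (auto simp: filterlim_at)
  have "\<forall>\<^sub>F n in sequentially. f (X n) \<in> borel_measurable M \<and> (AE s in M. norm (f (X n) s) \<le> w s)"
    using eventually_conj[OF f bnd] fl by (auto dest: eventually_compose_filterlim)
  then obtain N where N: "\<And>n. n \<ge> N \<Longrightarrow> f (X n) \<in> borel_measurable M"
    "\<And>n. n \<ge> N \<Longrightarrow> AE s in M. norm (f (X n) s) \<le> w s"
    by (auto simp: eventually_sequentially)
  show "(\<lambda>n. integral\<^sup>L M (f (X n))) \<longlonglongrightarrow> integral\<^sup>L M g"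
  proof (rule LIMSEQ_offset[where k=N], rule integral_dominated_convergence[OF g _ w])
    show "f (X (n + N)) \<in> borel_measurable M" for n by (rule N) simp
    show "AE s in M. norm (f (X (n + N)) s) \<le> w s" for n by (rule N) simp
    show "AE s in M. (\<lambda>n. f (X (n + N)) s) \<longlonglongrightarrow> g s"
      using lim
    proof eventually_elim
      fix s assume "((\<lambda>x. f x s) \<longlongrightarrow> g s) (at x0 within S)"
      from filterlim_compose[OF this fl] show "(\<lambda>n. f (X (n + N)) s) \<longlonglongrightarrow> g s"
        by (rule LIMSEQ_ignore_initial_segment)
    qed
  qed
qed

definition locally_dominated ::
  "'x::metric_space set \<Rightarrow> 's measure \<Rightarrow> ('x \<Rightarrow> 's \<Rightarrow> 'b::real_normed_vector) \<Rightarrow> bool" where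
  "locally_dominated S M F \<longleftrightarrow>
     (\<forall>x\<in>S. \<exists>e>0. \<exists>B. integrable M B \<and> (\<forall>x'\<in>ball x e \<inter> S. \<forall>s. norm (F x' s) \<le> B s))"

lemma locally_dominated_integrable:
  fixes F :: "'x::metric_space \<Rightarrow> 's \<Rightarrow> 'b::{banach, second_countable_topology}"
  assumes "locally_dominated S M F" "x \<in> S" "F x \<in> borel_measurable M"
  shows "integrable M (F x)"
proof -
  obtain e B where "e > 0" "integrable M B" "\<forall>x'\<in>ball x e \<inter> S. \<forall>s. norm (F x' s) \<le> B s"
    using assms(1,2) unfolding locally_dominated_def by blast
  then have "\<And>s. norm (F x s) \<le> norm (B s)"
    using assms(2) by (metis IntI centre_in_ball real_norm_def abs_ge_self order_trans)
  then show ?thesis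
    by (intro Bochner_Integration.integrable_bound[OF \<open>integrable M B\<close> assms(3)] AE_I2)
qed

lemma continuous_on_integral_param:
  fixes F :: "'x::metric_space \<Rightarrow> 's \<Rightarrow> 'b::{banach, second_countable_topology}"
  assumes dom: "locally_dominated S M F" and S: "open S"
    and meas: "\<And>x. x \<in> S \<Longrightarrow> F x \<in> borel_measurable M"
    and cont: "\<And>s. continuous_on S (\<lambda>x. F x s)"
  shows "continuous_on S (\<lambda>x. integral\<^sup>L M (F x))"
  unfolding continuous_on_def
proof
  fix x assume x: "x \<in> S"
  obtain e B where eB: "e > 0" "integrable M B" "\<forall>x'\<in>ball x e \<inter> S. \<forall>s. norm (F x' s) \<le> B s"
    using dom x unfolding locally_dominated_def by blast
  have ev: "\<forall>\<^sub>F x' in at x within S. x' \<in> ball x e \<inter> S"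
    unfolding eventually_at using eB(1) by (auto simp: dist_commute)
  show "((\<lambda>x. integral\<^sup>L M (F x)) \<longlongrightarrow> integral\<^sup>L M (F x)) (at x within S)"
  proof (rule dominated_convergence_filter[OF eB(2) meas[OF x]])
    show "\<forall>\<^sub>F x in at x within S. F x \<in> borel_measurable M"
      using ev by eventually_elim (auto intro: meas)
    show "\<forall>\<^sub>F x in at x within S. AE s in M. norm (F x s) \<le> B s"
      using ev by eventually_elim (use eB(3) in auto)
    show "AE s in M. ((\<lambda>x. F x s) \<longlongrightarrow> F x s) (at x within S)"
      using cont x by (auto simp: continuous_on_def)
  qed
qed

text \<open>
  The difference quotients are dominated through the mean value inequality, once the derivative has
  an integrable bound that is linear in the direction. Such a bound is assembled from the bounds in
  the finitely many basis directions, so the hypothesis on each single direction suffices.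
\<close>

lemma has_derivative_integral_param:
  fixes F :: "'x::euclidean_space \<Rightarrow> 's \<Rightarrow> 'b::{banach, second_countable_topology}"
  assumes S: "open S" and x: "x \<in> S"
    and int: "\<And>x. x \<in> S \<Longrightarrow> integrable M (F x)"
    and der: "\<And>x s. x \<in> S \<Longrightarrow> ((\<lambda>x. F x s) has_derivative (\<lambda>v. F' v x s)) (at x)"
    and meas: "\<And>v x. x \<in> S \<Longrightarrow> F' v x \<in> borel_measurable M"
    and dom: "\<And>v. locally_dominated S M (F' v)"
  shows "((\<lambda>x. integral\<^sup>L M (F x)) has_derivative (\<lambda>v. integral\<^sup>L M (F' v x))) (at x)"
proof -
  have "\<forall>v. \<exists>e B. e > 0 \<and> integrable M B \<and> (\<forall>x'\<in>ball x e \<inter> S. \<forall>s. norm (F' v x' s) \<le> B s)"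
    using dom x unfolding locally_dominated_def by meson
  then obtain e B where eB: "\<And>v. e v > 0" "\<And>v. integrable M (B v)"
    "\<And>v x' s. x' \<in> ball x (e v) \<inter> S \<Longrightarrow> norm (F' v x' s) \<le> B v s"
    by metis
  obtain d where d: "d > 0" "ball x d \<subseteq> S" using S x open_contains_ball by blast
  define r where "r = Min (insert d (e ` Basis))"
  have r: "r > 0" "r \<le> d" "\<And>b. b \<in> Basis \<Longrightarrow> r \<le> e b"
    unfolding r_def using d eB(1) by (auto intro!: Min_le simp del: Min_insert)
  \<comment> \<open>one integrable function that bounds the derivative in all directions of norm at most \<open>1\<close>\<close>
  define W where "W s = (\<Sum>b\<in>Basis. B b s)" for s
  have W: "integrable M W" unfolding W_def using eB(2) by auto
  have lin: "bounded_linear (\<lambda>v. F' v x' s)" if "x' \<in> S" for x' s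
    using der[OF that] by (rule has_derivative_bounded_linear)
  have rS: "x' \<in> S" if "x' \<in> ball x r" for x' using that d r by auto
  have bound: "norm (F' v x' s) \<le> norm v * W s" if x': "x' \<in> ball x r" for x' v s
  proof -
    interpret bounded_linear "\<lambda>v. F' v x' s" by (rule lin) (rule rS[OF x'])
    have "F' v x' s = F' (\<Sum>b\<in>Basis. (v \<bullet> b) *\<^sub>R b) x' s" by (simp add: euclidean_representation)
    also have "\<dots> = (\<Sum>b\<in>Basis. (v \<bullet> b) *\<^sub>R F' b x' s)" by (simp add: sum scaleR)
    finally have "norm (F' v x' s) \<le> (\<Sum>b\<in>Basis. norm ((v \<bullet> b) *\<^sub>R F' b x' s))"
      by (simp only: norm_sum)
    also have "\<dots> \<le> (\<Sum>b\<in>Basis. norm v * B b s)"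
    proof (rule sum_mono)
      fix b :: 'x assume b: "b \<in> Basis"
      have "norm (F' b x' s) \<le> B b s" using eB(3)[of x' b s] x' rS[OF x'] r(3)[OF b] by auto
      then show "norm ((v \<bullet> b) *\<^sub>R F' b x' s) \<le> norm v * B b s"
        using Basis_le_norm[OF b, of v] by (auto intro!: mult_mono)
    qed
    finally show ?thesis by (simp add: W_def sum_distrib_left)
  qed
  have intF': "integrable M (F' v x)" for v
    by (rule Bochner_Integration.integrable_bound[OF integrable_mult_right[OF W, of "norm v"] meas[OF x]])
      (use bound[of x v] r(1) in \<open>auto intro: order_trans[OF _ abs_ge_self]\<close>)
  have lin': "bounded_linear (\<lambda>v. integral\<^sup>L M (F' v x))"
  proof (rule bounded_linear_intro[where K="integral\<^sup>L M W"])
    fix u v c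
    show "integral\<^sup>L M (F' (u + v) x) = integral\<^sup>L M (F' u x) + integral\<^sup>L M (F' v x)"
      by (subst ext[of "F' (u + v) x" "\<lambda>s. F' u x s + F' v x s"])
        (simp_all add: intF' linear_simps(1)[OF lin[OF x]])
    show "integral\<^sup>L M (F' (c *\<^sub>R v) x) = c *\<^sub>R integral\<^sup>L M (F' v x)"
      by (subst ext[of "F' (c *\<^sub>R v) x" "\<lambda>s. c *\<^sub>R F' v x s"])
        (simp_all add: linear_simps(5)[OF lin[OF x]])
    have "norm (integral\<^sup>L M (F' v x)) \<le> (\<integral>s. norm v * W s \<partial>M)"
      using intF' W bound[of x v] r(1)
      by (intro order_trans[OF integral_norm_bound] integral_mono) auto
    then show "norm (integral\<^sup>L M (F' v x)) \<le> norm v * integral\<^sup>L M W" by simp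
  qed
  define q where "q x' s = (F x' s - F x s - F' (x' - x) x s) /\<^sub>R norm (x' - x)" for x' s
  have qb: "norm (q x' s) \<le> 2 * W s" if x': "x' \<in> ball x r" for x' s
  proof -
    have "norm (F x' s - F x s) \<le> W s * norm (x' - x)"
    proof (rule differentiable_bound[of "ball x r" "\<lambda>x. F x s" "\<lambda>z v. F' v z s"])
      show "((\<lambda>x. F x s) has_derivative (\<lambda>v. F' v z s)) (at z within ball x r)"
        if "z \<in> ball x r" for z
        using der[OF rS[OF that], of s] by (rule has_derivative_at_withinI)
      show "onorm (\<lambda>v. F' v z s) \<le> W s" if "z \<in> ball x r" for z
        using bound[OF that, of _ s] by (intro onorm_le) (simp add: mult.commute)
    qed (use x' r(1) in auto)
    moreover have "norm (F' (x' - x) x s) \<le> norm (x' - x) * W s"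
      by (rule bound) (use r in auto)
    ultimately have "norm (F x' s - F x s - F' (x' - x) x s) \<le> norm (x' - x) * (2 * W s)"
      using norm_triangle_ineq4[of "F x' s - F x s" "F' (x' - x) x s"] by (simp add: algebra_simps)
    moreover have "0 \<le> B b s" for b
      using eB(1)[of b] x by (intro order_trans[OF norm_ge_zero eB(3)[of x]]) auto
    then have "0 \<le> W s" unfolding W_def by (intro sum_nonneg)
    ultimately show ?thesis
      by (cases "x' = x") (auto simp: q_def divide_simps mult.commute)
  qed
  have ev: "\<forall>\<^sub>F x' in at x. x' \<in> ball x r" using r(1) by (intro eventually_at_in_open') auto
  have "((\<lambda>x'. integral\<^sup>L M (q x')) \<longlongrightarrow> (\<integral>s. 0 \<partial>M)) (at x)"
  proof (rule dominated_convergence_filter)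
    show "integrable M (\<lambda>s. 2 * W s)" using W by simp
    show "\<forall>\<^sub>F x in at x. q x \<in> borel_measurable M"
      using ev
    proof eventually_elim
      case (elim x')
      show ?case unfolding q_def
        by (intro borel_measurable_scaleR borel_measurable_diff borel_measurable_const
            borel_measurable_integrable int intF' x rS elim)
    qed
    show "\<forall>\<^sub>F x in at x. AE s in M. norm (q x s) \<le> 2 * W s"
      using ev by eventually_elim (use qb in auto)
    show "AE s in M. ((\<lambda>x. q x s) \<longlongrightarrow> 0) (at x)"
      using der[OF x] by (auto simp: has_derivative_at_within q_def)
  qed simp
  moreover have "\<forall>\<^sub>F x' in at x. integral\<^sup>L M (q x') =
      (integral\<^sup>L M (F x') - integral\<^sup>L M (F x) - integral\<^sup>L M (F' (x' - x) x)) /\<^sub>R norm (x' - x)"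
    using ev
  proof eventually_elim
    case (elim x')
    show ?case unfolding q_def using int[OF rS[OF elim]] int[OF x] intF'[of "x' - x"] by simp
  qed
  ultimately show ?thesis
    using lin' by (simp add: has_derivative_at_within tendsto_cong)
qed

section \<open>Gaussian integrals and Fourier inversion\<close>

lemma fixes f :: "'a::euclidean_space \<Rightarrow> real \<Rightarrow> 'b::{real_normed_field, banach, second_countable_topology}"
  assumes "\<And>b. b \<in> Basis \<Longrightarrow> integrable lborel (f b)"
  shows integrable_prod_coordinates: "integrable lborel (\<lambda>x::'a. \<Prod>b\<in>Basis. f b (x \<bullet> b))"
    and integral_prod_coordinates:
      "(\<integral>x. (\<Prod>b\<in>(Basis::'a set). f b (x \<bullet> b)) \<partial>lborel) = (\<Prod>b\<in>Basis. integral\<^sup>L lborel (f b))"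
proof -
  interpret product_sigma_finite "\<lambda>b::'a. lborel :: real measure" ..
  have T: "(\<lambda>g. \<Sum>b\<in>Basis. g b *\<^sub>R b) \<in> (\<Pi>\<^sub>M b\<in>(Basis::'a set). lborel) \<rightarrow>\<^sub>M borel" by measurable
  have [measurable]: "f b \<in> borel_measurable borel" if "b \<in> Basis" for b
    using borel_measurable_integrable[OF assms[OF that]] by simp
  have m: "(\<lambda>x::'a. \<Prod>b\<in>Basis. f b (x \<bullet> b)) \<in> borel_measurable borel" by measurable
  have eq: "(\<Prod>b\<in>Basis. f b ((\<Sum>c\<in>Basis. g c *\<^sub>R c) \<bullet> b)) = (\<Prod>b\<in>(Basis::'a set). f b (g b))" for g
    by (intro prod.cong) auto
  show "integrable lborel (\<lambda>x::'a. \<Prod>b\<in>Basis. f b (x \<bullet> b))"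
    using product_integrable_prod[of "Basis :: 'a set" f] assms
    by (subst lborel_eq) (simp add: integrable_distr_eq[OF T m] eq)
  show "(\<integral>x. (\<Prod>b\<in>(Basis::'a set). f b (x \<bullet> b)) \<partial>lborel) = (\<Prod>b\<in>Basis. integral\<^sup>L lborel (f b))"
    using product_integral_prod[of "Basis :: 'a set" f] assms
    by (subst lborel_eq) (simp add: integral_distr[OF T m] eq)
qed

lemma fixes f :: "'a::euclidean_space \<Rightarrow> 'b::{banach, second_countable_topology}"
  assumes "c \<noteq> 0"
  shows lborel_integrable_scale_iff: "integrable lborel (\<lambda>x. f (c *\<^sub>R x)) \<longleftrightarrow> integrable lborel f"
    and lborel_integral_scale: "integral\<^sup>L lborel f = \<bar>c\<bar> ^ DIM('a) *\<^sub>R (\<integral>x. f (c *\<^sub>R x) \<partial>lborel)"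
proof -
  have int: "integrable lborel (\<lambda>x. f (c *\<^sub>R x))"
    if f: "integrable lborel f" and c: "c \<noteq> 0" for f :: "'a \<Rightarrow> 'b" and c :: real
  proof -
    have [measurable]: "f \<in> borel_measurable borel" using borel_measurable_integrable[OF f] by simp
    have "integrable (density (distr lborel borel (\<lambda>x. 0 + c *\<^sub>R x)) (\<lambda>_. \<bar>c\<bar> ^ DIM('a))) f"
      using f lborel_affine[OF c, of "0::'a"] by simp
    then have "integrable lborel (\<lambda>x. \<bar>c\<bar> ^ DIM('a) *\<^sub>R f (c *\<^sub>R x))"
      by (simp add: integrable_density integrable_distr_eq)
    from integrable_scaleR_right[OF this, of "inverse (\<bar>c\<bar> ^ DIM('a))"] show ?thesis
      using c by simp
  qed
  show iff: "integrable lborel (\<lambda>x. f (c *\<^sub>R x)) \<longleftrightarrow> integrable lborel f"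
    using int[of f c] int[of "\<lambda>x. f (c *\<^sub>R x)" "1 / c"] assms by auto
  show "integral\<^sup>L lborel f = \<bar>c\<bar> ^ DIM('a) *\<^sub>R (\<integral>x. f (c *\<^sub>R x) \<partial>lborel)"
  proof (cases "integrable lborel f")
    case True
    then have [measurable]: "f \<in> borel_measurable borel" using borel_measurable_integrable[OF True] by simp
    show ?thesis
      by (subst lborel_affine[OF assms, of 0]) (simp add: integral_density integral_distr)
  next
    case False
    then show ?thesis using iff by (simp add: not_integrable_integral_eq)
  qed
qed

text \<open>
  After rescaling, the integral is the characteristic function of the standard normal
  distribution.
\<close>

lemma fixes x e :: real
  assumes "e > 0"
  shows integrable_gaussian_iexp: "integrable lborel (\<lambda>s. iexp (s * x) * of_real (exp (- (e * s)\<^sup>2 / 2)))"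
    and fourier_gaussian: "(\<integral>s. iexp (s * x) * of_real (exp (- (e * s)\<^sup>2 / 2)) \<partial>lborel) =
      of_real (sqrt (2 * pi) / e * exp (- (x / e)\<^sup>2 / 2))"
proof -
  define h where "h s = iexp (s * (x / e)) * complex_of_real (exp (- s\<^sup>2 / 2))" for s :: real
  have h: "h s = complex_of_real (sqrt (2 * pi)) * (std_normal_density s *\<^sub>R iexp ((x / e) * s))" for s
    by (simp add: h_def std_normal_density_def scaleR_conv_of_real mult_ac)
  have "integrable std_normal_distribution (\<lambda>s. iexp ((x / e) * s))"
    using real_dist_normal_dist by (intro prob_space.integrable_iexp) (auto simp: real_distribution_def)
  then have "integrable lborel (\<lambda>s. std_normal_density s *\<^sub>R iexp ((x / e) * s))"
    by (subst (asm) integrable_density) auto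
  then have hi: "integrable lborel h" unfolding h[abs_def] by (rule integrable_mult_right)
  have "integral\<^sup>L lborel h = of_real (sqrt (2 * pi)) * (\<integral>s. std_normal_density s *\<^sub>R iexp ((x / e) * s) \<partial>lborel)"
    unfolding h[abs_def] by (rule integral_mult_right_zero)
  also have "(\<integral>s. std_normal_density s *\<^sub>R iexp ((x / e) * s) \<partial>lborel) = char std_normal_distribution (x / e)"
    unfolding char_def by (subst integral_density) auto
  finally have hI: "integral\<^sup>L lborel h = of_real (sqrt (2 * pi) * exp (- (x / e)\<^sup>2 / 2))"
    by (simp add: char_std_normal_distribution)
  have eq: "(\<lambda>s. iexp (s * x) * of_real (exp (- (e * s)\<^sup>2 / 2))) = (\<lambda>s. h (e *\<^sub>R s))"
    using assms by (auto simp: h_def)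
  show "integrable lborel (\<lambda>s. iexp (s * x) * of_real (exp (- (e * s)\<^sup>2 / 2)))"
    unfolding eq using hi lborel_integrable_scale_iff[of e h] assms by blast
  show "(\<integral>s. iexp (s * x) * of_real (exp (- (e * s)\<^sup>2 / 2)) \<partial>lborel) =
      of_real (sqrt (2 * pi) / e * exp (- (x / e)\<^sup>2 / 2))"
    unfolding eq using lborel_integral_scale[of e h] assms hI
    by (simp add: scaleR_conv_of_real field_simps)
qed

lemma norm_sq_Basis: "(norm (x::'a::euclidean_space))\<^sup>2 = (\<Sum>b\<in>Basis. (x \<bullet> b)\<^sup>2)"
  by (simp add: norm_eq_sqrt_inner euclidean_inner[of x x] power2_eq_square sum_nonneg)

lemma fixes w :: "'a::euclidean_space"
  assumes "e > 0"
  shows integrable_gaussian_iexp_euclidean: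
      "integrable lborel (\<lambda>s::'a. iexp (s \<bullet> w) * of_real (exp (- (e * norm s)\<^sup>2 / 2)))" (is ?I)
    and fourier_gaussian_euclidean:
      "(\<integral>s. iexp (s \<bullet> w) * of_real (exp (- (e * norm s)\<^sup>2 / 2)) \<partial>lborel) =
        of_real ((sqrt (2 * pi) / e) ^ DIM('a) * exp (- (norm w / e)\<^sup>2 / 2))" (is ?F)
proof -
  let ?f = "\<lambda>b s. iexp (s * (w \<bullet> b)) * complex_of_real (exp (- (e * s)\<^sup>2 / 2))"
  have eq: "iexp (s \<bullet> w) * of_real (exp (- (e * norm s)\<^sup>2 / 2)) = (\<Prod>b\<in>Basis. ?f b (s \<bullet> b))" for s :: 'a
    unfolding prod.distrib
    by (simp add: euclidean_inner[of s w] sum_distrib_left sum_negf power_mult_distrib norm_sq_Basis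
        sum_divide_distrib flip: exp_sum exp_of_real of_real_prod)
  have eq2: "exp (- (norm w / e)\<^sup>2 / 2) = (\<Prod>b\<in>Basis. exp (- ((w \<bullet> b) / e)\<^sup>2 / 2))"
    by (simp add: power_divide norm_sq_Basis sum_negf sum_divide_distrib flip: exp_sum)
  show ?I unfolding eq by (intro integrable_prod_coordinates integrable_gaussian_iexp assms)
  show ?F unfolding eq eq2
    by (subst integral_prod_coordinates, rule integrable_gaussian_iexp[OF assms])
      (simp only: fourier_gaussian[OF assms], simp add: prod.distrib prod_dividef power_divide)
qed

lemma integral_exp_norm_sq:
  assumes "c > 0"
  shows "integrable lborel (\<lambda>x::'a::euclidean_space. exp (- c * (norm x)\<^sup>2))"
    and "(\<integral>x. exp (- c * (norm (x::'a::euclidean_space))\<^sup>2) \<partial>lborel) = sqrt (pi / c) ^ DIM('a)"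
proof -
  have e: "sqrt (2 * c) > 0" using assms by simp
  have eq: "iexp (s \<bullet> 0) * complex_of_real (exp (- (sqrt (2 * c) * norm s)\<^sup>2 / 2)) =
      of_real (exp (- c * (norm s)\<^sup>2))" for s :: 'a
    using assms by (simp add: power_mult_distrib del: exp_of_real)
  show I: "integrable lborel (\<lambda>x::'a. exp (- c * (norm x)\<^sup>2))"
    using integrable_gaussian_iexp_euclidean[OF e, of "0::'a"]
    unfolding eq by (simp only: complex_of_real_integrable_eq)
  have "sqrt (2 * pi) / sqrt (2 * c) = sqrt (pi / c)"
    by (simp flip: real_sqrt_divide)
  then show "(\<integral>x. exp (- c * (norm (x::'a::euclidean_space))\<^sup>2) \<partial>lborel) = sqrt (pi / c) ^ DIM('a)"
    using fourier_gaussian_euclidean[OF e, of "0::'a"]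
    unfolding eq integral_complex_of_real by (simp only: of_real_eq_iff) simp
qed

text \<open>
  The form in which absolute convergence is checked before each exchange of integrals below.
\<close>

lemma integrable_product_bound:
  fixes f :: "'a::euclidean_space \<Rightarrow> 'b::euclidean_space \<Rightarrow> complex"
  assumes f: "case_prod f \<in> borel_measurable (lborel \<Otimes>\<^sub>M lborel)"
    and g: "integrable lborel g" and h: "integrable lborel h"
    and bound: "\<And>x y. norm (f x y) \<le> g x * h y"
  shows "integrable (lborel \<Otimes>\<^sub>M lborel) (case_prod f)"
proof (rule Bochner_Integration.integrable_bound[OF _ f])
  have [measurable]: "g \<in> borel_measurable lborel" "h \<in> borel_measurable lborel"
    using g h by auto
  show "integrable (lborel \<Otimes>\<^sub>M lborel) (\<lambda>(x, y). g x * h y)"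
  proof (rule lborel_pair.Fubini_integrable)
    have "(\<lambda>x. \<integral>y. norm (case (x, y) of (x, y) \<Rightarrow> g x * h y) \<partial>lborel) =
        (\<lambda>x. \<bar>g x\<bar> * (\<integral>y. \<bar>h y\<bar> \<partial>lborel))" by (simp add: abs_mult)
    then show "integrable lborel (\<lambda>x. \<integral>y. norm (case (x, y) of (x, y) \<Rightarrow> g x * h y) \<partial>lborel)"
      using g by simp
  qed (use h in auto)
  show "AE z in lborel \<Otimes>\<^sub>M lborel. norm (case_prod f z) \<le> norm (case z of (x, y) \<Rightarrow> g x * h y)"
    using bound by (intro AE_I2) (auto split: prod.split intro: order_trans[OF _ abs_ge_self])
qed

text \<open>
  The integral of the Fourier transform is regularised by a Gaussian factor of width \<open>1/e\<close>. By Fubini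
  and the Fourier transform of the Gaussian, the regularised integral is \<open>(2\<pi>)\<^sup>d\<close> times the average of \<open>h\<close>
  against a Gaussian of width \<open>e\<close>. As \<open>e \<rightarrow> 0\<close> the average tends to \<open>h 0\<close> by continuity, and the
  regularised integral to the integral of the transform by its integrability.
\<close>

lemma fourier_inversion_at_0:
  fixes h :: "'a::euclidean_space \<Rightarrow> complex"
  assumes h: "integrable lborel h" and cont: "isCont h 0"
    and bound: "\<And>w. norm (h w) \<le> K"
    and hat: "integrable lborel (\<lambda>s. \<integral>w. iexp (s \<bullet> w) * h w \<partial>lborel)"
  shows "(\<integral>s. (\<integral>w. iexp (s \<bullet> w) * h w \<partial>lborel) \<partial>lborel) = of_real ((2 * pi) ^ DIM('a)) * h 0"
proof -
  define H where "H s = (\<integral>w. iexp (s \<bullet> w) * h w \<partial>lborel)" for s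
  define G where "G e s = exp (- (e * norm (s::'a))\<^sup>2 / 2)" for e s
  define c where "c = complex_of_real (sqrt (2 * pi) ^ DIM('a))"
  have [measurable]: "h \<in> borel_measurable borel" using borel_measurable_integrable[OF h] by simp
  have G_meas[measurable]: "G e \<in> borel_measurable borel" for e unfolding G_def by measurable
  have Gint: "integrable lborel (G e)" if "e > 0" for e
    using integral_exp_norm_sq(1)[of "e\<^sup>2 / 2"] that by (simp add: G_def[abs_def] power_mult_distrib mult_ac)
  have swap: "(\<integral>s. of_real (G e s) * H s \<partial>lborel) = c * (\<integral>v. of_real (G 1 v) * h (e *\<^sub>R v) \<partial>lborel)"
    if e: "e > 0" for e
  proof -
    have int: "integrable (lborel \<Otimes>\<^sub>M lborel) (\<lambda>(s, w). of_real (G e s) * (iexp (s \<bullet> w) * h w))"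
      by (rule integrable_product_bound[where g="G e" and h="\<lambda>w. norm (h w)"])
        (use Gint[OF e] h in \<open>auto simp: norm_mult G_def\<close>)
    have "(\<integral>s. of_real (G e s) * H s \<partial>lborel) =
        (\<integral>s. (\<integral>w. of_real (G e s) * (iexp (s \<bullet> w) * h w) \<partial>lborel) \<partial>lborel)"
      by (simp add: H_def)
    also have "\<dots> = (\<integral>w. (\<integral>s. of_real (G e s) * (iexp (s \<bullet> w) * h w) \<partial>lborel) \<partial>lborel)"
      by (rule lborel_pair.Fubini_integral[OF int, symmetric])
    also have "(\<lambda>w. (\<integral>s. of_real (G e s) * (iexp (s \<bullet> w) * h w) \<partial>lborel)) =
        (\<lambda>w. h w * (\<integral>s. iexp (s \<bullet> w) * of_real (G e s) \<partial>lborel))"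
      by (subst integral_mult_right_zero[symmetric]) (simp add: mult_ac)
    also have "\<dots> = (\<lambda>w. h w * of_real ((sqrt (2 * pi) / e) ^ DIM('a) * G (1 / e) w))"
      unfolding G_def fourier_gaussian_euclidean[OF e] by simp
    also have "(\<integral>w. h w * of_real ((sqrt (2 * pi) / e) ^ DIM('a) * G (1 / e) w) \<partial>lborel) =
       \<bar>e\<bar> ^ DIM('a) *\<^sub>R (\<integral>v. h (e *\<^sub>R v) * of_real ((sqrt (2 * pi) / e) ^ DIM('a) * G (1 / e) (e *\<^sub>R v)) \<partial>lborel)"
      using e by (subst lborel_integral_scale[where c=e]) auto
    also have "(\<lambda>v. h (e *\<^sub>R v) * of_real ((sqrt (2 * pi) / e) ^ DIM('a) * G (1 / e) (e *\<^sub>R v))) =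
        (\<lambda>v. (c / of_real (e ^ DIM('a))) * (of_real (G 1 v) * h (e *\<^sub>R v)))"
      using e by (simp add: G_def c_def power_divide mult_ac)
    also have "\<bar>e\<bar> ^ DIM('a) *\<^sub>R (\<integral>v. (c / of_real (e ^ DIM('a))) * (of_real (G 1 v) * h (e *\<^sub>R v)) \<partial>lborel) =
        c * (\<integral>v. of_real (G 1 v) * h (e *\<^sub>R v) \<partial>lborel)"
      using e by (simp add: scaleR_conv_of_real)
    finally show ?thesis .
  qed
  define d where "d n = 1 / real (Suc n)" for n
  have d: "d \<longlonglongrightarrow> 0" "\<And>n. d n > 0" unfolding d_def using LIMSEQ_Suc[OF lim_1_over_n] by auto
  have Hm[measurable]: "H \<in> borel_measurable borel"
    using borel_measurable_integrable[OF hat] by (simp add: H_def[abs_def])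
  have "(\<lambda>n. \<integral>s. of_real (G (d n) s) * H s \<partial>lborel) \<longlonglongrightarrow> (\<integral>s. H s \<partial>lborel)"
  proof (rule integral_dominated_convergence[where w="\<lambda>s. norm (H s)"])
    show "integrable lborel (\<lambda>s. norm (H s))" using hat by (simp add: H_def[abs_def])
    show "AE s in lborel. (\<lambda>n. of_real (G (d n) s) * H s) \<longlonglongrightarrow> H s"
    proof (rule AE_I2)
      fix s
      have "(\<lambda>n. complex_of_real (G (d n) s) * H s) \<longlonglongrightarrow> of_real (exp (- (0 * norm s)\<^sup>2 / 2)) * H s"
        unfolding G_def by (intro tendsto_intros d) simp
      then show "(\<lambda>n. of_real (G (d n) s) * H s) \<longlonglongrightarrow> H s" by simp
    qed
    show "AE s in lborel. norm (of_real (G (d n) s) * H s) \<le> norm (H s)" for n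
      by (auto simp: norm_mult G_def intro!: mult_left_le_one_le)
  qed auto
  moreover have "(\<lambda>n. c * (\<integral>v. of_real (G 1 v) * h (d n *\<^sub>R v) \<partial>lborel)) \<longlonglongrightarrow>
      c * (\<integral>v. of_real (G 1 v) * h 0 \<partial>lborel)"
  proof (intro tendsto_mult_left integral_dominated_convergence[where w="\<lambda>v. G 1 v * K"])
    show "integrable lborel (\<lambda>v. G 1 v * K)" using Gint[of 1] by simp
    show "AE v in lborel. (\<lambda>n. of_real (G 1 v) * h (d n *\<^sub>R v)) \<longlonglongrightarrow> of_real (G 1 v) * h 0"
    proof (rule AE_I2)
      fix v :: 'a
      have "(\<lambda>n. d n *\<^sub>R v) \<longlonglongrightarrow> 0 *\<^sub>R v" by (intro tendsto_intros d)
      then have "(\<lambda>n. h (d n *\<^sub>R v)) \<longlonglongrightarrow> h 0" using isCont_tendsto_compose[OF cont] by simp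
      then show "(\<lambda>n. of_real (G 1 v) * h (d n *\<^sub>R v)) \<longlonglongrightarrow> of_real (G 1 v) * h 0"
        by (intro tendsto_intros)
    qed
    show "AE v in lborel. norm (of_real (G 1 v) * h (d n *\<^sub>R v)) \<le> G 1 v * K" for n
      using bound by (auto simp: norm_mult G_def)
  qed auto
  ultimately have "(\<integral>s. H s \<partial>lborel) = c * (\<integral>v. of_real (G 1 v) * h 0 \<partial>lborel)"
    using LIMSEQ_unique swap[OF d(2)] by (auto simp del: integral_mult_left_zero)
  also have "(\<integral>v. of_real (G 1 v) * h 0 \<partial>lborel) = of_real (\<integral>v. G 1 v \<partial>lborel) * h 0" by simp
  also have "(\<integral>v. G 1 v \<partial>lborel) = sqrt (2 * pi) ^ DIM('a)"
    using integral_exp_norm_sq(2)[of "1/2", where 'a='a] by (simp add: G_def[abs_def] mult.commute)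
  finally have "(\<integral>s. H s \<partial>lborel) = c * c * h 0" by (simp add: c_def)
  also have "c * c = of_real ((2 * pi) ^ DIM('a))"
    unfolding c_def of_real_mult[symmetric] power_mult_distrib[symmetric] by simp
  finally show ?thesis by (simp only: H_def)
qed

section \<open>The coefficients of the Mehler kernel\<close>

text \<open>
  The Mehler kernel of \<open>\<Delta> - r\<^sup>2 |y|\<^sup>2 / 4\<close> on \<open>\<real>\<^sup>4\<close> at time \<open>t\<close> is \<open>(amp r t / (4\<pi>))\<^sup>2 exp (- |y|\<^sup>2 rate r t / 4)\<close>.
  For \<open>r = 0\<close> both functions below take the value \<open>0\<close> by the convention for division, not their
  limit \<open>1/t\<close>. This is harmless, since \<open>r\<close> vanishes at one frequency only, and convenient, since the
  differential equations and the upper bounds below then hold for every \<open>r \<ge> 0\<close>.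
\<close>

definition amp :: "real \<Rightarrow> real \<Rightarrow> real" where
  "amp r t = r / sinh (r * t)"

definition rate :: "real \<Rightarrow> real \<Rightarrow> real" where
  "rate r t = r * cosh (r * t) / sinh (r * t)"

lemma amp_has_derivative:
  assumes "t > 0"
  shows "(amp r has_real_derivative - amp r t * rate r t) (at t)"
proof (cases "r = 0")
  case False
  with assms have "sinh (r * t) \<noteq> 0" by simp
  then show ?thesis unfolding amp_def[abs_def] rate_def
    by (auto intro!: derivative_eq_intros simp: field_simps power2_eq_square)
qed (simp add: amp_def[abs_def])

lemma rate_sq: "t > 0 \<Longrightarrow> (rate r t)\<^sup>2 = r\<^sup>2 + (amp r t)\<^sup>2"
  by (cases "r = 0") (simp_all add: rate_def amp_def power_divide power_mult_distrib cosh_square_eq field_simps)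

lemma rate_has_derivative:
  assumes "t > 0"
  shows "(rate r has_real_derivative - (amp r t)\<^sup>2) (at t)"
proof (cases "r = 0")
  case False
  with assms have s: "sinh (r * t) \<noteq> 0" by simp
  have "(rate r has_real_derivative
      (r * (sinh (r * t) * r) * sinh (r * t) - r * cosh (r * t) * (cosh (r * t) * r)) / (sinh (r * t) * sinh (r * t))) (at t)"
    unfolding rate_def[abs_def] using s by (auto intro!: derivative_eq_intros)
  also have "(r * (sinh (r * t) * r) * sinh (r * t) - r * cosh (r * t) * (cosh (r * t) * r)) =
      r\<^sup>2 * ((sinh (r * t))\<^sup>2 - (cosh (r * t))\<^sup>2)"
    by (simp add: power2_eq_square algebra_simps)
  also have "\<dots> / (sinh (r * t) * sinh (r * t)) = - (amp r t)\<^sup>2"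
    using s by (subst cosh_square_eq) (simp add: amp_def power_divide power2_eq_square)
  finally show ?thesis .
qed (simp add: rate_def[abs_def] amp_def)

lemma amp_nonneg: "r \<ge> 0 \<Longrightarrow> t > 0 \<Longrightarrow> amp r t \<ge> 0"
  by (simp add: amp_def)

lemma rate_nonneg: "r \<ge> 0 \<Longrightarrow> t > 0 \<Longrightarrow> rate r t \<ge> 0"
  by (simp add: rate_def)

lemma le_sinh: "x \<ge> 0 \<Longrightarrow> x \<le> sinh (x::real)"
  using real_le_x_sinh[of x] by (simp add: sinh_field_def exp_minus)

lemma sinh_le_mult_cosh:
  assumes "x \<ge> (0::real)" shows "sinh x \<le> x * cosh x"
proof -
  have "(\<lambda>x. x * cosh x - sinh x) 0 \<le> (\<lambda>x. x * cosh x - sinh x) x"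
    by (rule deriv_nonneg_imp_mono[where g'="\<lambda>x. x * sinh x"])
      (use assms in \<open>auto intro!: derivative_eq_intros\<close>)
  then show ?thesis by simp
qed

lemma amp_le_inverse: "r \<ge> 0 \<Longrightarrow> t > 0 \<Longrightarrow> t * amp r t \<le> 1"
  using le_sinh[of "r * t"] by (cases "r = 0") (simp_all add: amp_def field_simps)

text \<open>
  The duplication formula for \<open>sinh\<close> gives \<open>sinh u = 2 sinh (u/2) cosh (u/2) \<ge> u exp (u/2) / 2\<close>. The
  resulting exponential decay in \<open>r\<close> makes the frequency integrals converge.
\<close>

lemma amp_le_exp:
  assumes r: "r \<ge> 0" and t: "t > 0"
  shows "amp r t \<le> 2 / t * exp (- (r * t / 2))"
proof (cases "r = 0")
  case False
  have "r * t / 2 * (exp (r * t / 2) / 2) \<le> sinh (r * t / 2) * cosh (r * t / 2)"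
    using le_sinh[of "r * t / 2"] r t by (intro mult_mono) (auto simp: cosh_field_def)
  then have "r * t / 2 * exp (r * t / 2) \<le> sinh (r * t)"
    using sinh_double[of "r * t / 2"] by simp
  moreover have "sinh (r * t) > 0" using r t False by simp
  ultimately show ?thesis using t by (simp add: amp_def exp_minus field_simps)
qed (use t in \<open>simp add: amp_def\<close>)

text \<open>
  With \<open>u = r t\<close> the claim is \<open>u (cosh u - sinh u) \<le> sinh u\<close>, where the left side is \<open>u exp (- u) \<le> u\<close>.
\<close>

lemma rate_le:
  assumes r: "r \<ge> 0" and t: "t > 0"
  shows "rate r t \<le> r + 1 / t"
proof (cases "r = 0")
  case False
  define u where "u = r * t"
  have u: "u > 0" using r t False by (simp add: u_def)
  have "u * (cosh u - sinh u) \<le> u * 1" using u by (intro mult_left_mono) (auto simp: cosh_minus_sinh)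
  then have "u * cosh u \<le> (u + 1) * sinh u" using le_sinh[of u] u by (simp add: algebra_simps)
  then have "u * cosh u / sinh u \<le> u + 1" using u by (simp add: field_simps)
  then have "rate r t * t \<le> r * t + 1" by (simp add: rate_def u_def mult_ac)
  then show ?thesis using t by (simp add: field_simps)
qed (use t in \<open>simp add: rate_def\<close>)

lemma rate_ge: "r > 0 \<Longrightarrow> t > 0 \<Longrightarrow> 1 \<le> t * rate r t"
  using sinh_le_mult_cosh[of "r * t"] by (simp add: rate_def field_simps)

lemma amp_scaled_tendsto:
  assumes "r > 0" shows "((\<lambda>t. t * amp r t) \<longlongrightarrow> 1) (at_right 0)"
  unfolding amp_def sinh_field_def using assms by real_asymp

lemma rate_scaled_tendsto:
  assumes "r > 0" shows "((\<lambda>t. t * rate r t) \<longlongrightarrow> 1) (at_right 0)"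
  unfolding rate_def sinh_field_def cosh_field_def using assms by real_asymp

section \<open>Decay and growth in the frequency variable\<close>

text \<open>
  An integrable weight that is a product of functions of single coordinates and dominates every
  sufficiently high negative power of \<open>1 + norm s\<close>.
\<close>

definition cauchy_weight :: "'a::euclidean_space \<Rightarrow> real" where
  "cauchy_weight s = (\<Prod>b\<in>Basis. inverse (1 + (s \<bullet> b)\<^sup>2))"

lemma integrable_cauchy_weight: "integrable lborel (cauchy_weight :: 'a::euclidean_space \<Rightarrow> real)"
  unfolding cauchy_weight_def[abs_def]
  using integrable_inverse_1_plus_square
  by (intro integrable_prod_coordinates) (simp add: set_integrable_def)

lemma cauchy_weight_ge:
  fixes s :: "'a::euclidean_space"
  shows "1 \<le> (1 + norm s) ^ (2 * DIM('a)) * cauchy_weight s"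
proof -
  have "1 + (s \<bullet> b)\<^sup>2 \<le> (1 + norm s)\<^sup>2" if "b \<in> Basis" for b
    using power_mono[OF Basis_le_norm[OF that, of s] abs_ge_zero, of 2] norm_ge_zero[of s]
    unfolding power2_sum power2_abs one_power2 mult_1_right by linarith
  then have "(\<Prod>b\<in>Basis. 1 + (s \<bullet> b)\<^sup>2) \<le> (\<Prod>b\<in>(Basis::'a set). (1 + norm s)\<^sup>2)"
    by (intro prod_mono) (auto simp: add_nonneg_nonneg)
  also have "\<dots> = (1 + norm s) ^ (2 * DIM('a))" by (simp add: power_mult)
  finally have "(\<Prod>b\<in>Basis. 1 + (s \<bullet> b)\<^sup>2) \<le> (1 + norm s) ^ (2 * DIM('a))" .
  moreover have "(\<Prod>b\<in>Basis. 1 + (s \<bullet> b)\<^sup>2) > 0"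
    by (intro prod_pos) (auto simp: add_pos_nonneg)
  moreover have "cauchy_weight s = inverse (\<Prod>b\<in>Basis. 1 + (s \<bullet> b)\<^sup>2)"
    using prod_inversef[of "\<lambda>b. 1 + (s \<bullet> b)\<^sup>2" Basis] by (simp add: cauchy_weight_def comp_def)
  ultimately show ?thesis by (simp add: field_simps)
qed

lemma cauchy_weight_nonneg: "0 \<le> cauchy_weight s"
  unfolding cauchy_weight_def by (intro prod_nonneg) auto

lemma le_cauchy_weight:
  fixes s :: "'a::euclidean_space"
  assumes "(1 + norm s) ^ (2 * DIM('a)) * x \<le> K" "0 \<le> x"
  shows "x \<le> K * cauchy_weight s"
proof -
  have "x * 1 \<le> x * ((1 + norm s) ^ (2 * DIM('a)) * cauchy_weight s)"
    using cauchy_weight_ge[of s] assms(2) by (intro mult_left_mono)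
  also have "\<dots> = ((1 + norm s) ^ (2 * DIM('a)) * x) * cauchy_weight s" by simp
  also have "\<dots> \<le> K * cauchy_weight s" using assms(1) cauchy_weight_nonneg by (rule mult_right_mono)
  finally show ?thesis by simp
qed

lemma power_mult_exp_bounded:
  fixes c :: real
  assumes "c > 0"
  obtains K where "\<And>r. r \<ge> 0 \<Longrightarrow> (1 + r) ^ k * exp (- (c * r)) \<le> K"
proof
  fix r :: real assume r: "r \<ge> 0"
  \<comment> \<open>\<open>Suc k\<close> rather than \<open>k\<close>, so that \<open>d > 0\<close> also for \<open>k = 0\<close>\<close>
  define d where "d = c / Suc k"
  have d: "d > 0" using assms by (simp add: d_def)
  have "d * (1 + r) \<le> exp (d * (1 + r))"
    using exp_ge_add_one_self[of "d * (1 + r)"] by linarith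
  then have "(d * (1 + r)) ^ k \<le> exp (d * (1 + r)) ^ k"
    using d r by (intro power_mono) auto
  also have "\<dots> = exp (of_nat k * (d * (1 + r)))" by (simp add: exp_of_nat_mult)
  also have "\<dots> \<le> exp (c * (1 + r))"
  proof -
    have "of_nat k * d \<le> c" using assms by (simp add: d_def field_simps)
    from mult_right_mono[OF this, of "1 + r"] r show ?thesis by (simp add: mult.assoc)
  qed
  finally have "d ^ k * (1 + r) ^ k \<le> exp c * exp (c * r)"
    unfolding power_mult_distrib by (simp add: distrib_left[of c] exp_add)
  then show "(1 + r) ^ k * exp (- (c * r)) \<le> exp c / d ^ k"
    using d by (simp add: exp_minus field_simps)
qed

lemma integrable_power_mult_exp:
  fixes c :: real
  assumes "c > 0"
  shows "integrable lborel (\<lambda>s::'a::euclidean_space. (1 + norm s) ^ k * exp (- (c * norm s)))"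
proof -
  obtain K where K: "\<And>r. r \<ge> 0 \<Longrightarrow> (1 + r) ^ (2 * DIM('a) + k) * exp (- (c * r)) \<le> K"
    using power_mult_exp_bounded[OF assms] by blast
  have le: "(1 + norm s) ^ k * exp (- (c * norm s)) \<le> K * cauchy_weight s" for s :: 'a
    using K[of "norm s"] by (intro le_cauchy_weight) (auto simp: power_add mult.assoc)
  show ?thesis
  proof (rule Bochner_Integration.integrable_bound)
    show "integrable lborel (\<lambda>s::'a. K * cauchy_weight s)"
      by (rule integrable_mult_right) (rule integrable_cauchy_weight)
    show "AE s::'a in lborel. norm ((1 + norm s) ^ k * exp (- (c * norm s))) \<le> norm (K * cauchy_weight s)"
      using le by (auto intro: order_trans[OF _ abs_ge_self])
  qed simp
qed

text \<open>
  The class of coefficients that appear when a mode of the kernel is differentiated. It is closed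
  under the ring operations, so membership is proved by structural rules; multiplication by a factor
  that decays exponentially in the frequency makes each of its members integrable.
\<close>

definition moderate :: "'x::metric_space set \<Rightarrow> ('x \<Rightarrow> 's::euclidean_space \<Rightarrow> complex) \<Rightarrow> bool" where
  "moderate S T \<longleftrightarrow>
     (\<forall>x\<in>S. T x \<in> borel_measurable borel) \<and> (\<forall>s. continuous_on S (\<lambda>x. T x s)) \<and>
     (\<forall>x\<in>S. \<exists>e>0. \<exists>K k. \<forall>x'\<in>ball x e \<inter> S. \<forall>s. norm (T x' s) \<le> K * (1 + norm s) ^ k)"

lemma moderate_boundE:
  assumes "moderate S T" "x \<in> S"
  obtains e K k where "e > 0" "K \<ge> 0"
    "\<And>x' s. x' \<in> ball x e \<inter> S \<Longrightarrow> norm (T x' s) \<le> K * (1 + norm s) ^ k"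
proof -
  obtain e K k where e: "e > 0" and b: "\<forall>x'\<in>ball x e \<inter> S. \<forall>s. norm (T x' s) \<le> K * (1 + norm s) ^ k"
    using assms unfolding moderate_def by blast
  have "norm (T x 0) \<le> K * (1 + norm (0::'b)) ^ k" using b[rule_format, of x 0] e assms(2) by simp
  then have "K \<ge> 0" using b[rule_format, of x 0] e assms(2) order_trans[OF norm_ge_zero] by auto
  then show thesis using that e b by blast
qed

lemma moderate_of_parameter:
  fixes f :: "'x::metric_space \<Rightarrow> complex"
  assumes "continuous_on S f"
  shows "moderate S (\<lambda>x (s::'s::euclidean_space). f x)"
  unfolding moderate_def
proof (intro conjI ballI)
  fix x assume x: "x \<in> S"
  obtain e where e: "e > 0" "\<And>x'. x' \<in> S \<Longrightarrow> dist x' x < e \<Longrightarrow> dist (f x') (f x) < 1"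
    using assms x unfolding continuous_on_iff by (meson zero_less_one)
  have "norm (f x') \<le> (norm (f x) + 1) * (1 + norm s) ^ 0" if "x' \<in> ball x e \<inter> S" for x' and s :: 's
    using e(2)[of x'] that norm_triangle_sub[of "f x'" "f x"] by (auto simp: dist_commute) (auto simp: dist_norm)
  then show "\<exists>e>0. \<exists>K k. \<forall>x'\<in>ball x e \<inter> S. \<forall>s::'s. norm (f x') \<le> K * (1 + norm s) ^ k"
    using e(1) by blast
qed (use assms in auto)

lemma moderate_of_frequency:
  assumes "g \<in> borel_measurable borel" "\<And>s. norm (g s) \<le> K * (1 + norm s) ^ k"
  shows "moderate S (\<lambda>x s. g s)"
  unfolding moderate_def
proof (intro conjI ballI allI)
  show "\<exists>e>0. \<exists>K k. \<forall>x'\<in>ball x e \<inter> S. \<forall>s. norm (g s) \<le> K * (1 + norm s) ^ k" for x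
    using assms(2) by (intro exI[of _ 1] conjI exI[of _ K] exI[of _ k]) auto
qed (use assms(1) in auto)

text \<open>
  Sums and products are both bounded by \<open>(1 + norm T) (1 + norm U)\<close>, so one estimate serves for the
  two closure rules.
\<close>

lemma moderate_combine:
  assumes T: "moderate S T" and U: "moderate S U"
    and meas: "\<And>x. x \<in> S \<Longrightarrow> V x \<in> borel_measurable borel" and cont: "\<And>s. continuous_on S (\<lambda>x. V x s)"
    and bound: "\<And>x s. norm (V x s) \<le> (1 + norm (T x s)) * (1 + norm (U x s))"
  shows "moderate S V"
  unfolding moderate_def
proof (intro conjI ballI allI)
  fix x assume x: "x \<in> S"
  obtain e K k where e: "e > 0" "K \<ge> 0"
      "\<And>x' s. x' \<in> ball x e \<inter> S \<Longrightarrow> norm (T x' s) \<le> K * (1 + norm s) ^ k"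
    using moderate_boundE[OF T x] by blast
  obtain d J j where d: "d > 0" "J \<ge> 0"
      "\<And>x' s. x' \<in> ball x d \<inter> S \<Longrightarrow> norm (U x' s) \<le> J * (1 + norm s) ^ j"
    using moderate_boundE[OF U x] by blast
  have "norm (V x' s) \<le> ((1 + K) * (1 + J)) * (1 + norm s) ^ (k + j)" if x': "x' \<in> ball x (min e d) \<inter> S" for x' s
  proof -
    have p: "1 \<le> (1 + norm s) ^ k" "1 \<le> (1 + norm s) ^ j" by (simp_all add: one_le_power)
    have "1 + norm (T x' s) \<le> (1 + K) * (1 + norm s) ^ k" "1 + norm (U x' s) \<le> (1 + J) * (1 + norm s) ^ j"
      using e(3)[of x' s] d(3)[of x' s] x' p
      unfolding distrib_right mult_1_left by (auto intro!: add_mono)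
    note le = mult_mono[OF this]
    have "norm (V x' s) \<le> (1 + norm (T x' s)) * (1 + norm (U x' s))" by (rule bound)
    also have "\<dots> \<le> ((1 + K) * (1 + norm s) ^ k) * ((1 + J) * (1 + norm s) ^ j)"
      using e(2) by (intro le) auto
    finally show ?thesis by (simp add: power_add mult_ac)
  qed
  then show "\<exists>e>0. \<exists>K k. \<forall>x'\<in>ball x e \<inter> S. \<forall>s. norm (V x' s) \<le> K * (1 + norm s) ^ k"
    using e(1) d(1)
    by (intro exI[of _ "min e d"] conjI exI[of _ "(1 + K) * (1 + J)"] exI[of _ "k + j"]) auto
qed (use meas cont in auto)

lemma moderate_add:
  assumes "moderate S T" "moderate S U"
  shows "moderate S (\<lambda>x s. T x s + U x s)"
proof (rule moderate_combine[OF assms])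
  show "norm (T x s + U x s) \<le> (1 + norm (T x s)) * (1 + norm (U x s))" for x s
    using norm_triangle_ineq[of "T x s" "U x s"]
      mult_nonneg_nonneg[OF norm_ge_zero norm_ge_zero, of "T x s" "U x s"]
    unfolding distrib_left distrib_right by linarith
qed (use assms in \<open>auto simp: moderate_def intro: continuous_intros borel_measurable_add\<close>)

lemma moderate_mult:
  assumes "moderate S T" "moderate S U"
  shows "moderate S (\<lambda>x s. T x s * U x s)"
proof (rule moderate_combine[OF assms])
  show "norm (T x s * U x s) \<le> (1 + norm (T x s)) * (1 + norm (U x s))" for x s
    by (simp add: norm_mult algebra_simps)
qed (use assms in \<open>auto simp: moderate_def intro: continuous_intros borel_measurable_times\<close>)

lemma moderate_const: "moderate S (\<lambda>x s. c)"
  by (rule moderate_of_parameter) simp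

lemma moderate_uminus: "moderate S T \<Longrightarrow> moderate S (\<lambda>x s. - T x s)"
  using moderate_mult[OF moderate_const[of S "-1"], of T] by simp

lemma moderate_diff: "moderate S T \<Longrightarrow> moderate S U \<Longrightarrow> moderate S (\<lambda>x s. T x s - U x s)"
  using moderate_add[OF _ moderate_uminus[of S U], of T] by simp

lemma moderate_sum:
  "(\<And>i. i \<in> I \<Longrightarrow> moderate S (T i)) \<Longrightarrow> moderate S (\<lambda>x s. \<Sum>i\<in>I. T i x s)"
  by (induction I rule: infinite_finite_induct) (auto intro: moderate_add moderate_const)

lemmas moderate_intros =
  moderate_const moderate_add moderate_mult moderate_uminus moderate_diff moderate_sum

section \<open>Derivatives of products and of continuously differentiable functions\<close>

text \<open>
  The logarithmic derivative of a product is the sum of the logarithmic derivatives. Stating the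
  factors' derivatives in the form \<open>f \<cdot> c\<close> avoids dividing by factors that may vanish.
\<close>

lemma has_derivative_prod_log:
  fixes f :: "'i \<Rightarrow> 'x::real_normed_vector \<Rightarrow> real"
  assumes "finite I" "\<And>i. i \<in> I \<Longrightarrow> (f i has_derivative (\<lambda>v. f i x * c i v)) (at x)"
  shows "((\<lambda>x. \<Prod>i\<in>I. f i x) has_derivative (\<lambda>v. (\<Prod>i\<in>I. f i x) * (\<Sum>i\<in>I. c i v))) (at x)"
  using assms
proof (induction I)
  case (insert j I)
  have "((\<lambda>x. f j x * (\<Prod>i\<in>I. f i x)) has_derivative
      (\<lambda>v. f j x * ((\<Prod>i\<in>I. f i x) * (\<Sum>i\<in>I. c i v)) + f j x * c j v * (\<Prod>i\<in>I. f i x))) (at x)"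
    using insert by (intro has_derivative_mult) auto
  then show ?case using insert by (simp add: algebra_simps)
qed simp

lemma Ck_on_cong:
  assumes "open S" "\<And>x. x \<in> S \<Longrightarrow> f x = g x"
  shows "Ck_on k f S \<Longrightarrow> Ck_on k g S"
  using assms(2)
proof (induction k arbitrary: f g)
  case 0
  then show ?case by (simp cong: continuous_on_cong)
next
  case (Suc k)
  have eq: "(g has_derivative frechet_derivative f (at x)) (at x)" if x: "x \<in> S" for x
    using has_derivative_transform_within_open[of f "frechet_derivative f (at x)" x UNIV S g]
      Suc.prems x assms(1) by (simp add: frechet_derivative_works)
  have fg: "frechet_derivative f (at x) v = frechet_derivative g (at x) v" if "x \<in> S" for x v
    using frechet_derivative_at[OF eq[OF that]] by simp
  show ?case unfolding Ck_on.simps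
  proof (intro conjI ballI allI)
    show "g differentiable at x" if "x \<in> S" for x using eq[OF that] by (rule differentiableI)
    show "Ck_on k (\<lambda>x. frechet_derivative g (at x) v) S" for v
      by (rule Suc.IH[of "\<lambda>x. frechet_derivative f (at x) v"]) (use Suc.prems(1) fg in auto)
  qed
qed

text \<open>
  The definition asks for the Frechet derivative as chosen by an operator; on an open set it may be
  replaced by any family that is known to be the derivative there.
\<close>

lemma Ck_on_SucI:
  assumes S: "open S" and f: "\<And>x. x \<in> S \<Longrightarrow> (f has_derivative (\<lambda>v. f' v x)) (at x)"
    and f': "\<And>v. Ck_on k (f' v) S"
  shows "Ck_on (Suc k) f S"
  unfolding Ck_on.simps
proof (intro conjI ballI allI)
  show "f differentiable at x" if "x \<in> S" for x using f[OF that] by (rule differentiableI)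
  show "Ck_on k (\<lambda>x. frechet_derivative f (at x) v) S" for v
    by (rule Ck_on_cong[OF S _ f'[of v]]) (simp add: frechet_derivative_at[OF f, symmetric])
qed

lemma Ck_on_mult_const:
  fixes f :: "'a::real_normed_vector \<Rightarrow> complex"
  assumes S: "open S" and f: "Ck_on k f S"
  shows "Ck_on k (\<lambda>x. f x * c) S"
  using f
proof (induction k arbitrary: f)
  case 0
  then show ?case by (auto intro: continuous_intros)
next
  case (Suc k)
  show ?case
  proof (rule Ck_on_SucI[OF S])
    show "((\<lambda>x. f x * c) has_derivative (\<lambda>v. frechet_derivative f (at x) v * c)) (at x)" if "x \<in> S" for x
      using Suc.prems that by (intro has_derivative_mult_left) (simp add: frechet_derivative_works)
    show "Ck_on k (\<lambda>x. frechet_derivative f (at x) v * c) S" for v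
      using Suc.prems by (intro Suc.IH) simp
  qed
qed

section \<open>Test functions and the partial Fourier transform\<close>

lemma lborel_integral_translation:
  fixes f :: "'a::euclidean_space \<Rightarrow> 'b::{banach, second_countable_topology}"
  assumes "f \<in> borel_measurable borel"
  shows "(\<integral>x. f (x + c) \<partial>lborel) = integral\<^sup>L lborel f"
proof -
  have "integral\<^sup>L lborel f = integral\<^sup>L (distr lborel borel ((+) c)) f" by (simp only: lborel_distr_plus)
  also have "\<dots> = (\<integral>x. f (c + x) \<partial>lborel)" using assms by (intro integral_distr) auto
  finally show ?thesis by (simp add: add.commute)
qed

lemma integrable_indicator_cball:
  "integrable lborel (\<lambda>x::'a::euclidean_space. M * indicator (cball c R) x :: real)"
  by (intro integrable_mult_right integrable_real_indicator emeasure_compact_finite) auto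

lemma test_function_continuous: "test_function \<phi> \<Longrightarrow> continuous_on UNIV \<phi>"
  unfolding test_function_def by (metis Ck_on.simps(1))

lemma test_function_has_derivative:
  assumes "test_function \<phi>"
  shows "(\<phi> has_derivative frechet_derivative \<phi> (at x)) (at x)"
proof -
  have "Ck_on (Suc 0) \<phi> UNIV" using assms unfolding test_function_def by blast
  then show ?thesis by (simp add: frechet_derivative_works)
qed

text \<open>
  Differentiation does not enlarge the support: off the closed support the function vanishes in a
  neighbourhood.
\<close>

lemma test_function_derivative:
  assumes "test_function \<phi>"
  shows "test_function (\<lambda>x. frechet_derivative \<phi> (at x) v)"
  unfolding test_function_def
proof (intro conjI allI)
  fix k
  have "Ck_on (Suc k) \<phi> UNIV" using assms unfolding test_function_def by blast
  then show "Ck_on k (\<lambda>x. frechet_derivative \<phi> (at x) v) UNIV" by simp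
next
  let ?K = "closure {x. \<phi> x \<noteq> 0}"
  have "frechet_derivative \<phi> (at x) v = 0" if x: "x \<notin> ?K" for x
  proof -
    have "(\<phi> has_derivative (\<lambda>_. 0)) (at x)"
    proof (rule has_derivative_transform_within_open[of "\<lambda>_. 0" _ x UNIV "- ?K"])
      show "0 = \<phi> x'" if "x' \<in> - ?K" for x' using that closure_subset[of "{x. \<phi> x \<noteq> 0}"] by auto
    qed (use x in auto)
    from frechet_derivative_at[OF this] show ?thesis by metis
  qed
  then have "{x. frechet_derivative \<phi> (at x) v \<noteq> 0} \<subseteq> ?K" by blast
  then have "closure {x. frechet_derivative \<phi> (at x) v \<noteq> 0} \<subseteq> ?K" by (rule closure_minimal) simp
  moreover have "compact ?K" using assms unfolding test_function_def by blast
  ultimately show "compact (closure {x. frechet_derivative \<phi> (at x) v \<noteq> 0})"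
    using compact_Int_closed[of ?K "closure {x. frechet_derivative \<phi> (at x) v \<noteq> 0}"]
    by (simp add: Int_absorb1)
qed

lemma test_function_bounded_support:
  fixes \<phi> :: "'a::euclidean_space \<Rightarrow> complex"
  assumes "test_function \<phi>"
  obtains M R where "M > 0" "R > 0" "\<And>x. norm (\<phi> x) \<le> M * indicator (cball 0 R) x"
proof -
  have K: "compact (closure {x. \<phi> x \<noteq> 0})" using assms unfolding test_function_def by blast
  obtain R where R: "R > 0" "\<forall>x\<in>closure {x. \<phi> x \<noteq> 0}. norm x \<le> R"
    using compact_imp_bounded[OF K] unfolding bounded_pos by (elim exE conjE) (rule that)
  have "compact (\<phi> ` cball 0 R)"
    by (intro compact_continuous_image continuous_on_subset[OF test_function_continuous[OF assms]]) auto
  from compact_imp_bounded[OF this] obtain M where M: "M > 0" "\<forall>z\<in>\<phi> ` cball 0 R. norm z \<le> M"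
    unfolding bounded_pos by (elim exE conjE) (rule that)
  have "norm (\<phi> x) \<le> M * indicator (cball 0 R) x" for x
  proof (cases "x \<in> cball 0 R")
    case False
    then have "x \<notin> closure {x. \<phi> x \<noteq> 0}" using R(2) by auto
    then have "\<phi> x = 0" using closure_subset[of "{x. \<phi> x \<noteq> 0}"] by auto
    then show ?thesis using M(1) by simp
  qed (use M in auto)
  then show thesis by (rule that[OF M(1) R(1)])
qed

lemma test_function_integrable:
  fixes \<phi> :: "'a::euclidean_space \<Rightarrow> complex"
  assumes "test_function \<phi>"
  shows "integrable lborel \<phi>"
proof -
  obtain M R where MR: "M > 0" "R > 0" "\<And>x. norm (\<phi> x) \<le> M * indicator (cball 0 R) x"
    by (rule test_function_bounded_support[OF assms]) (rule that)
  show ?thesis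
  proof (rule Bochner_Integration.integrable_bound)
    show "integrable lborel (\<lambda>x::'a. M * indicator (cball 0 R) x)" by (rule integrable_indicator_cball)
    show "AE x in lborel. norm (\<phi> x) \<le> norm (M * indicator (cball 0 R) x)"
      using MR by (auto intro: order_trans[OF _ abs_ge_self])
  qed (use borel_measurable_continuous_onI[OF test_function_continuous[OF assms]] in simp)
qed

definition partial_fourier ::
  "('a::euclidean_space \<times> 'b::euclidean_space \<Rightarrow> complex) \<Rightarrow> 'a \<Rightarrow> 'b \<Rightarrow> complex" where
  "partial_fourier \<phi> y s = (\<integral>w. iexp (s \<bullet> w) * \<phi> (y, w) \<partial>lborel)"

lemma test_function_slice_bound:
  fixes \<phi> :: "'a::euclidean_space \<times> 'b::euclidean_space \<Rightarrow> complex"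
  assumes "test_function \<phi>"
  obtains M R where "M > 0" "R > 0" "\<And>y w. norm (\<phi> (y, w)) \<le> M * indicator (cball 0 R) w"
proof -
  obtain M R where MR: "M > 0" "R > 0" "\<And>x. norm (\<phi> x) \<le> M * indicator (cball 0 R) x"
    by (rule test_function_bounded_support[OF assms]) (rule that)
  have "norm (\<phi> (y, w)) \<le> M * indicator (cball 0 R) w" for y w
  proof (cases "norm w \<le> R")
    case False
    then have "\<not> norm (y, w) \<le> R" using norm_snd_le[of w y] by linarith
    then show ?thesis using MR(1) MR(3)[of "(y, w)"] by (simp add: indicator_def)
  next
    case True
    have "norm (\<phi> (y, w)) \<le> M * 1"
      using MR(1) by (intro order_trans[OF MR(3)[of "(y, w)"] mult_left_mono]) (auto simp: indicator_def)
    with True show ?thesis by simp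
  qed
  then show thesis by (rule that[OF MR(1,2)])
qed

lemma slice_measurable:
  fixes \<phi> :: "'a::euclidean_space \<times> 'b::euclidean_space \<Rightarrow> complex"
  assumes "test_function \<phi>"
  shows "(\<lambda>w. \<phi> (y, w)) \<in> borel_measurable borel" "(\<lambda>w. iexp (s \<bullet> w) * \<phi> (y, w)) \<in> borel_measurable borel"
  by (intro borel_measurable_continuous_onI continuous_intros
      continuous_on_compose2[OF test_function_continuous[OF assms]] subset_UNIV)+

lemma integrable_slice:
  fixes \<phi> :: "'a::euclidean_space \<times> 'b::euclidean_space \<Rightarrow> complex"
  assumes "test_function \<phi>"
  shows "integrable lborel (\<lambda>w. \<phi> (y, w))" "integrable lborel (\<lambda>w. iexp (s \<bullet> w) * \<phi> (y, w))"
proof -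
  obtain M R where MR: "M > 0" "R > 0" "\<And>y w. norm (\<phi> (y, w)) \<le> M * indicator (cball 0 R) w"
    by (rule test_function_slice_bound[OF assms]) (rule that)
  show 1: "integrable lborel (\<lambda>w. \<phi> (y, w))"
  proof (rule Bochner_Integration.integrable_bound)
    show "integrable lborel (\<lambda>w::'b. M * indicator (cball 0 R) w)" by (rule integrable_indicator_cball)
    show "AE w in lborel. norm (\<phi> (y, w)) \<le> norm (M * indicator (cball 0 R) w)"
      using MR by (auto intro: order_trans[OF _ abs_ge_self])
  qed (use slice_measurable[OF assms] in simp)
  show "integrable lborel (\<lambda>w. iexp (s \<bullet> w) * \<phi> (y, w))"
    by (rule Bochner_Integration.integrable_bound[OF 1])
      (use slice_measurable[OF assms] in \<open>auto simp: norm_mult\<close>)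
qed

lemma partial_fourier_bounded:
  assumes "test_function \<phi>"
  obtains K where "\<And>y s. norm (partial_fourier \<phi> y s) \<le> K"
proof -
  obtain M R where MR: "M > 0" "R > 0" "\<And>y w. norm (\<phi> (y, w)) \<le> M * indicator (cball 0 R) w"
    by (rule test_function_slice_bound[OF assms]) (rule that)
  have "norm (partial_fourier \<phi> y s) \<le> (\<integral>w. M * indicator (cball 0 R) (w::'b) \<partial>lborel)" for y s
    unfolding partial_fourier_def
    by (rule Bochner_Integration.integral_norm_bound_integral[OF integrable_slice(2)[OF assms] integrable_indicator_cball])
      (use MR(3) in \<open>simp add: norm_mult\<close>)
  then show thesis by (rule that)
qed

lemma partial_fourier_continuous:
  assumes "test_function \<phi>"
  shows "continuous_on UNIV (\<lambda>y. partial_fourier \<phi> y s)"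
  unfolding partial_fourier_def
proof (rule continuous_on_integral_param)
  obtain M R where MR: "M > 0" "R > 0" "\<And>y w. norm (\<phi> (y, w)) \<le> M * indicator (cball 0 R) w"
    by (rule test_function_slice_bound[OF assms]) (rule that)
  show "locally_dominated UNIV lborel (\<lambda>y w. iexp (s \<bullet> w) * \<phi> (y, w))"
    unfolding locally_dominated_def
    by (intro ballI exI[of _ 1] conjI exI[of _ "\<lambda>w. M * indicator (cball 0 R) w"] integrable_indicator_cball)
      (use MR in \<open>auto simp: norm_mult\<close>)
  show "continuous_on UNIV (\<lambda>y. iexp (s \<bullet> w) * \<phi> (y, w))" for w
    by (intro continuous_intros continuous_on_compose2[OF test_function_continuous[OF assms]] subset_UNIV)
qed (use slice_measurable(2)[OF assms] in auto)

text \<open>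
  Instead of integrating by parts, the translate \<open>\<phi>(y, w + h b)\<close> is differentiated in \<open>h\<close> at \<open>0\<close>. By
  translation invariance of the integral its transform is \<open>exp (- i h s\<cdot>b)\<close> times the transform of \<open>\<phi>\<close>,
  and under the integral sign the derivative falls on \<open>\<phi>\<close>.
\<close>

lemma partial_fourier_derivative:
  fixes \<phi> :: "'a::euclidean_space \<times> 'b::euclidean_space \<Rightarrow> complex"
  assumes \<phi>: "test_function \<phi>"
  shows "partial_fourier (\<lambda>x. frechet_derivative \<phi> (at x) (0, b)) y s = - \<i> * of_real (s \<bullet> b) * partial_fourier \<phi> y s"
proof -
  define \<psi> where "\<psi> x = frechet_derivative \<phi> (at x) (0, b)" for x
  have \<psi>: "test_function \<psi>" unfolding \<psi>_def[abs_def] by (rule test_function_derivative[OF \<phi>])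
  obtain M R where MR: "M > 0" "R > 0" "\<And>y w. norm (\<psi> (y, w)) \<le> M * indicator (cball 0 R) w"
    by (rule test_function_slice_bound[OF \<psi>]) (rule that)
  define F where "F h w = iexp (s \<bullet> w) * \<phi> (y, w + h *\<^sub>R b)" for h :: real and w
  define F' where "F' u h w = iexp (s \<bullet> w) * (of_real u * \<psi> (y, w + h *\<^sub>R b))" for u h :: real and w
  have F: "integral\<^sup>L lborel (F h) = iexp (- h * (s \<bullet> b)) * partial_fourier \<phi> y s" for h
  proof -
    have "F h = (\<lambda>w. iexp (- h * (s \<bullet> b)) * (iexp (s \<bullet> (w + h *\<^sub>R b)) * \<phi> (y, w + h *\<^sub>R b)))"
      unfolding mult.assoc[symmetric] exp_add[symmetric]
      by (simp add: F_def[abs_def] inner_add_right algebra_simps)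
    then have "integral\<^sup>L lborel (F h) =
        iexp (- h * (s \<bullet> b)) * (\<integral>w. iexp (s \<bullet> (w + h *\<^sub>R b)) * \<phi> (y, w + h *\<^sub>R b) \<partial>lborel)"
      by (simp only: integral_mult_right_zero)
    also have "(\<integral>w. iexp (s \<bullet> (w + h *\<^sub>R b)) * \<phi> (y, w + h *\<^sub>R b) \<partial>lborel) = partial_fourier \<phi> y s"
      unfolding partial_fourier_def by (rule lborel_integral_translation[OF slice_measurable(2)[OF \<phi>]])
    finally show ?thesis .
  qed
  have meas: "F h \<in> borel_measurable borel" "F' u h \<in> borel_measurable borel" for u h
    unfolding F_def[abs_def] F'_def[abs_def]
    by (intro borel_measurable_continuous_onI continuous_intros
      continuous_on_compose2[OF test_function_continuous[OF \<phi>]]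
      continuous_on_compose2[OF test_function_continuous[OF \<psi>]] subset_UNIV)+
  have "((\<lambda>h. integral\<^sup>L lborel (F h)) has_derivative (\<lambda>u. integral\<^sup>L lborel (F' u 0))) (at 0)"
  proof (rule has_derivative_integral_param[where S="ball 0 1"])
    show "integrable lborel (F h)" for h
    proof -
      obtain M R where MR: "M > 0" "R > 0" "\<And>y w. norm (\<phi> (y, w)) \<le> M * indicator (cball 0 R) w"
        by (rule test_function_slice_bound[OF \<phi>]) (rule that)
      have "norm (F h w) \<le> norm (M * indicator (cball (- h *\<^sub>R b) R) w)" for w
      proof -
        have "- h *\<^sub>R b - w = 0 - (w + h *\<^sub>R b)" by (simp add: algebra_simps)
        then have "dist (- h *\<^sub>R b) w = dist 0 (w + h *\<^sub>R b)" by (simp only: dist_norm)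
        then have "indicator (cball 0 R) (w + h *\<^sub>R b) = (indicator (cball (- h *\<^sub>R b) R) w :: real)"
          unfolding indicator_def mem_cball by (simp only:)
        then show ?thesis using MR(1) MR(3)[of y "w + h *\<^sub>R b"] by (simp add: F_def norm_mult)
      qed
      then show ?thesis
        using meas(1) by (intro Bochner_Integration.integrable_bound[OF integrable_indicator_cball]) auto
    qed
    show "((\<lambda>h. F h w) has_derivative (\<lambda>u. F' u h w)) (at h)" for h w
    proof -
      have "((\<lambda>h. (y, w + h *\<^sub>R b)) has_derivative (\<lambda>u. u *\<^sub>R (0, b))) (at h)"
        by (auto intro!: derivative_eq_intros)
      from has_derivative_compose[OF this test_function_has_derivative[OF \<phi>]]
      have "((\<lambda>h. \<phi> (y, w + h *\<^sub>R b)) has_derivative (\<lambda>u. of_real u * \<psi> (y, w + h *\<^sub>R b))) (at h)"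
        using linear_scale[OF has_derivative_linear[OF test_function_has_derivative[OF \<phi>]], of "(y, w + h *\<^sub>R b)" _ "(0, b)"]
        by (simp add: \<psi>_def scaleR_conv_of_real)
      then show ?thesis unfolding F_def F'_def by (rule has_derivative_mult_right)
    qed
    show "locally_dominated (ball 0 1) lborel (F' u)" for u
      unfolding locally_dominated_def
    proof (intro ballI exI[of _ 1] conjI exI[of _ "\<lambda>w. \<bar>u\<bar> * (M * indicator (cball 0 (R + norm b)) w)"]
        allI integrable_mult_right[OF integrable_indicator_cball])
      fix x h :: real and w :: 'b assume "h \<in> ball x 1 \<inter> ball 0 1"
      then have h: "\<bar>h\<bar> < 1" by simp
      have "norm w \<le> norm (w + h *\<^sub>R b) + norm b"
        using norm_triangle_ineq4[of "w + h *\<^sub>R b" "h *\<^sub>R b"] h mult_right_mono[of "\<bar>h\<bar>" 1 "norm b"] by simp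
      then have "indicator (cball 0 R) (w + h *\<^sub>R b) \<le> (indicator (cball 0 (R + norm b)) w :: real)"
        by (auto simp: indicator_def)
      with MR(1) have "norm (\<psi> (y, w + h *\<^sub>R b)) \<le> M * indicator (cball 0 (R + norm b)) w"
        by (intro order_trans[OF MR(3)] mult_left_mono) auto
      then show "norm (F' u h w) \<le> \<bar>u\<bar> * (M * indicator (cball 0 (R + norm b)) w)"
        by (simp add: F'_def norm_mult mult_left_mono)
    qed auto
  qed (use meas in auto)
  moreover have "((\<lambda>h. integral\<^sup>L lborel (F h)) has_derivative
      (\<lambda>u. of_real u * (- \<i> * of_real (s \<bullet> b) * partial_fourier \<phi> y s))) (at 0)"
  proof -
    have "((\<lambda>h::real. \<i> * of_real (- h * (s \<bullet> b))) has_derivative (\<lambda>u. \<i> * of_real (- u * (s \<bullet> b)))) (at 0)"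
      by (intro has_derivative_mult_right has_derivative_of_real has_derivative_mult_left
          has_derivative_minus has_derivative_ident)
    from has_derivative_mult_left[OF has_derivative_compose[OF this DERIV_exp[unfolded has_field_derivative_def]],
        of "partial_fourier \<phi> y s"]
    show ?thesis unfolding F by (simp add: mult_ac)
  qed
  ultimately have "(\<lambda>u. integral\<^sup>L lborel (F' u 0)) =
      (\<lambda>u. of_real u * (- \<i> * of_real (s \<bullet> b) * partial_fourier \<phi> y s))"
    by (rule has_derivative_unique)
  from fun_cong[OF this, of 1] show ?thesis
    by (simp add: F'_def[abs_def] partial_fourier_def \<psi>_def)
qed

lemma partial_fourier_power_bounded:
  fixes \<phi> :: "'a::euclidean_space \<times> 'b::euclidean_space \<Rightarrow> complex"
  assumes "test_function \<phi>"
  shows "\<exists>K. \<forall>y s. \<bar>s \<bullet> b\<bar> ^ k * norm (partial_fourier \<phi> y s) \<le> K"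
  using assms
proof (induction k arbitrary: \<phi>)
  case 0
  obtain K where "\<And>y s. norm (partial_fourier \<phi> y s) \<le> K"
    by (rule partial_fourier_bounded[OF 0]) (rule that)
  then show ?case by auto
next
  case (Suc k)
  from Suc.IH[OF test_function_derivative[OF Suc.prems, of "(0, b)"]]
  show ?case unfolding partial_fourier_derivative[OF Suc.prems] by (simp add: norm_mult mult_ac)
qed

text \<open>
  Some coordinate is at least the norm divided by the dimension, so powers of single coordinates
  control powers of the norm.
\<close>

lemma power_norm_le_sum_Basis:
  fixes s :: "'a::euclidean_space"
  shows "(1 + norm s) ^ k \<le> 2 ^ k * (1 + (\<Sum>b\<in>Basis. (real DIM('a) * \<bar>s \<bullet> b\<bar>) ^ k))"
proof (cases "norm s \<le> 1")
  case True
  have "(1 + norm s) ^ k \<le> 2 ^ k * 1" using True by (simp add: power_mono)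
  also have "\<dots> \<le> 2 ^ k * (1 + (\<Sum>b\<in>Basis. (real DIM('a) * \<bar>s \<bullet> b\<bar>) ^ k))"
    by (intro mult_left_mono) (auto intro!: sum_nonneg)
  finally show ?thesis .
next
  case False
  have "\<exists>b\<in>Basis. norm s \<le> real DIM('a) * \<bar>s \<bullet> b\<bar>"
  proof (rule ccontr)
    assume "\<not> ?thesis"
    then have "(\<Sum>b\<in>Basis. real DIM('a) * \<bar>s \<bullet> b\<bar>) < (\<Sum>b\<in>(Basis::'a set). norm s)"
      by (intro sum_strict_mono) (auto simp: not_le)
    then have "(\<Sum>b\<in>Basis. \<bar>s \<bullet> b\<bar>) < norm s"
      by (simp add: sum_distrib_left[symmetric])
    then show False using norm_le_l1[of s] by simp
  qed
  then obtain b where b: "b \<in> Basis" "norm s \<le> real DIM('a) * \<bar>s \<bullet> b\<bar>" by blast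
  have "(1 + norm s) ^ k \<le> (2 * norm s) ^ k" using False by (intro power_mono) auto
  also have "\<dots> \<le> 2 ^ k * (real DIM('a) * \<bar>s \<bullet> b\<bar>) ^ k"
    using b(2) by (simp add: power_mult_distrib[of 2] power_mono)
  also have "(real DIM('a) * \<bar>s \<bullet> b\<bar>) ^ k \<le> (\<Sum>b\<in>Basis. (real DIM('a) * \<bar>s \<bullet> b\<bar>) ^ k)"
    using b(1) by (intro member_le_sum) auto
  also have "\<dots> \<le> 1 + \<dots>" by simp
  finally show ?thesis by simp
qed

text \<open>
  Applying the derivative rule repeatedly shows that every power of a coordinate of \<open>s\<close> times the
  transform is bounded; the power \<open>2 DIM('b)\<close> is what the weight requires.
\<close>

lemma partial_fourier_decay:
  fixes \<phi> :: "'a::euclidean_space \<times> 'b::euclidean_space \<Rightarrow> complex"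
  assumes "test_function \<phi>"
  obtains K where "K \<ge> 0" "\<And>y s. norm (partial_fourier \<phi> y s) \<le> K * cauchy_weight s"
proof -
  let ?k = "2 * DIM('b)"
  obtain K0 where K0: "\<And>y s. norm (partial_fourier \<phi> y s) \<le> K0"
    by (rule partial_fourier_bounded[OF assms]) (rule that)
  have "\<forall>b. \<exists>K. \<forall>y s. \<bar>s \<bullet> b\<bar> ^ ?k * norm (partial_fourier \<phi> y s) \<le> K"
    using partial_fourier_power_bounded[OF assms] by blast
  then obtain K1 where "\<forall>b y s. \<bar>s \<bullet> b\<bar> ^ ?k * norm (partial_fourier \<phi> y s) \<le> K1 b"
    by (rule choice[THEN exE])
  then have K1: "\<bar>s \<bullet> b\<bar> ^ ?k * norm (partial_fourier \<phi> y s) \<le> K1 b" for b y s by blast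
  define K where "K = 2 ^ ?k * (K0 + (\<Sum>b\<in>(Basis::'b set). real DIM('b) ^ ?k * K1 b))"
  have le: "(1 + norm s) ^ ?k * norm (partial_fourier \<phi> y s) \<le> K" for y s
  proof -
    let ?n = "norm (partial_fourier \<phi> y s)"
    have "(1 + norm s) ^ ?k * ?n \<le> (2 ^ ?k * (1 + (\<Sum>b\<in>Basis. (real DIM('b) * \<bar>s \<bullet> b\<bar>) ^ ?k))) * ?n"
      by (intro mult_right_mono power_norm_le_sum_Basis) simp
    also have "\<dots> = 2 ^ ?k * (?n + (\<Sum>b\<in>Basis. real DIM('b) ^ ?k * (\<bar>s \<bullet> b\<bar> ^ ?k * ?n)))"
      unfolding power_mult_distrib by (simp only: distrib_right mult.assoc sum_distrib_right mult_1_left)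
    also have "\<dots> \<le> K"
      unfolding K_def by (intro mult_left_mono add_mono sum_mono K0 K1) auto
    finally show ?thesis .
  qed
  have "0 \<le> K" using le[of 0 undefined] order_trans[OF norm_ge_zero] by simp
  then show thesis by (rule that) (rule le_cauchy_weight[OF le norm_ge_zero])
qed

section \<open>Fourier modes of the heat kernel\<close>

locale quaternionic_laplacian =
  fixes a :: "3 \<Rightarrow> 'n::finite \<Rightarrow> real"
  assumes a_pos: "a m l > 0"
begin

abbreviation lam :: "'n \<Rightarrow> real^3 \<Rightarrow> real" where
  "lam \<equiv> tau_norm a"

lemma lam_eq_norm: "lam l s = norm (\<chi> m. a m l * s $ m)"
  by (simp add: tau_norm_def norm_vec_def L2_set_def power_mult_distrib)

lemma lam_nonneg [simp]: "0 \<le> lam l s"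
  by (simp add: lam_eq_norm)

lemma lam_sq: "(lam l s)\<^sup>2 = (\<Sum>m\<in>UNIV. (a m l)\<^sup>2 * (s $ m)\<^sup>2)"
  by (simp add: tau_norm_def sum_nonneg)

lemma lam_measurable [measurable]: "lam l \<in> borel_measurable borel"
  unfolding tau_norm_def[abs_def] by (intro borel_measurable_continuous_onI continuous_intros)

lemma lam_scaleR:
  fixes s :: "real^3"
  assumes "t \<ge> 0"
  shows "lam l (t *\<^sub>R s) = t * lam l s"
proof -
  have "(\<chi> m. a m l * (t *\<^sub>R s) $ m) = t *\<^sub>R (\<chi> m. a m l * s $ m)"
    by (simp add: vec_eq_iff)
  then show ?thesis using assms by (simp add: lam_eq_norm)
qed

lemma lam_le: "lam l s \<le> (\<Sum>m\<in>UNIV. a m l) * norm s"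
proof -
  have "lam l s \<le> (\<Sum>m\<in>UNIV. norm ((\<chi> m. a m l * s $ m) $ m))"
    unfolding lam_eq_norm by (rule norm_le_l1_cart[unfolded real_norm_def[symmetric]])
  also have "\<dots> \<le> (\<Sum>m\<in>UNIV. a m l * norm s)"
    using a_pos component_le_norm_cart[of s]
    by (intro sum_mono) (simp add: abs_mult less_imp_le mult_left_mono)
  finally show ?thesis by (simp add: sum_distrib_right)
qed

text \<open>
  All \<open>a m l\<close> being positive, the least of them will do. Through this bound the decay of each block in
  \<open>|s|\<^sub>l\<close> becomes exponential decay in the frequency.
\<close>

lemma lam_ge: obtains c where "c > 0" "\<And>l s. c * norm s \<le> lam l s"
proof
  define c where "c = Min (range (\<lambda>(m, l). a m l))"
  show c: "c > 0" unfolding c_def using a_pos by (subst Min_gr_iff) auto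
  have le: "c \<le> a m l" for m l
    unfolding c_def by (rule Min_le) (auto intro: rangeI[of "\<lambda>(m, l). a m l" "(m, l)", simplified])
  fix l and s :: "real^3"
  have "c * norm s = norm (c *\<^sub>R s)" using c by simp
  also have "\<dots> \<le> lam l s"
    unfolding lam_eq_norm norm_vec_def
    by (intro L2_set_mono)
      (auto simp: abs_mult abs_of_pos[OF c] abs_of_pos[OF a_pos] intro!: mult_right_mono mult_nonneg_nonneg less_imp_le[OF c] le)
  finally show "c * norm s \<le> lam l s" .
qed

lemma lam_pos:
  assumes "s \<noteq> 0" shows "lam l s > 0"
proof -
  obtain c where "c > 0" "\<And>l s. c * norm s \<le> lam l s" using lam_ge by blast
  then show ?thesis using assms by (meson mult_pos_pos order_less_le_trans zero_less_norm_iff)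
qed

definition upper :: "('n quat \<times> real) set" where
  "upper = UNIV \<times> {0<..}"

lemma open_upper: "open upper"
  unfolding upper_def by (intro open_Times) auto

lemma upper_iff: "x \<in> upper \<longleftrightarrow> snd x > 0"
  by (cases x) (auto simp: upper_def)

text \<open>
  The parameter of a mode is a point of the group together with the time, \<open>x = ((y, w), t)\<close>.
\<close>

definition block :: "'n \<Rightarrow> 'n quat \<times> real \<Rightarrow> real^3 \<Rightarrow> real" where
  "block l x s = (amp (lam l s) (snd x))\<^sup>2 * exp (- ((norm (fst (fst x) $ l))\<^sup>2 / 4 * rate (lam l s) (snd x)))"

definition gauss :: "'n quat \<times> real \<Rightarrow> real^3 \<Rightarrow> real" where
  "gauss x s = (\<Prod>l\<in>UNIV. block l x s)"

definition mode :: "'n quat \<times> real \<Rightarrow> real^3 \<Rightarrow> complex" where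
  "mode x s = of_real (gauss x s) * iexp (s \<bullet> snd (fst x))"

text \<open>
  The logarithmic derivative of \<open>block l\<close> in the direction \<open>v\<close>, and the derivative of that
  expression in the direction \<open>u\<close>, with the derivatives of \<open>amp\<close> and \<open>rate\<close> eliminated.
\<close>

definition block_log :: "'n quat \<times> real \<Rightarrow> 'n quat \<times> real \<Rightarrow> real^3 \<Rightarrow> 'n \<Rightarrow> real" where
  "block_log v x s l =
     - 2 * rate (lam l s) (snd x) * snd v
     - 1/2 * (fst (fst x) $ l \<bullet> fst (fst v) $ l) * rate (lam l s) (snd x)
     + 1/4 * (fst (fst x) $ l \<bullet> fst (fst x) $ l) * (amp (lam l s) (snd x))\<^sup>2 * snd v"

definition block_log2 :: "'n quat \<times> real \<Rightarrow> 'n quat \<times> real \<Rightarrow> 'n quat \<times> real \<Rightarrow> real^3 \<Rightarrow> 'n \<Rightarrow> real" where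
  "block_log2 u v x s l =
     2 * (amp (lam l s) (snd x))\<^sup>2 * snd u * snd v
     - 1/2 * (fst (fst u) $ l \<bullet> fst (fst v) $ l) * rate (lam l s) (snd x)
     + 1/2 * (fst (fst x) $ l \<bullet> fst (fst v) $ l) * (amp (lam l s) (snd x))\<^sup>2 * snd u
     + 1/2 * (fst (fst x) $ l \<bullet> fst (fst u) $ l) * (amp (lam l s) (snd x))\<^sup>2 * snd v
     - 1/2 * (fst (fst x) $ l \<bullet> fst (fst x) $ l) * (amp (lam l s) (snd x))\<^sup>2 * rate (lam l s) (snd x) * snd u * snd v"

definition log_deriv :: "'n quat \<times> real \<Rightarrow> 'n quat \<times> real \<Rightarrow> real^3 \<Rightarrow> complex" where
  "log_deriv v x s = \<i> * of_real (s \<bullet> snd (fst v)) + (\<Sum>l\<in>UNIV. of_real (block_log v x s l))"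

definition log_deriv2 :: "'n quat \<times> real \<Rightarrow> 'n quat \<times> real \<Rightarrow> 'n quat \<times> real \<Rightarrow> real^3 \<Rightarrow> complex" where
  "log_deriv2 u v x s = (\<Sum>l\<in>UNIV. of_real (block_log2 u v x s l))"

lemma amp_snd_has_derivative:
  assumes "x \<in> upper"
  shows "((\<lambda>x. amp r (snd x)) has_derivative
    (\<lambda>v. - amp r (snd x) * rate r (snd x) * snd v)) (at x)"
proof -
  have "((\<lambda>x. amp r (snd x)) has_derivative (\<lambda>v. snd v * (- amp r (snd x) * rate r (snd x)))) (at x)"
    using assms by (intro DERIV_compose_FDERIV[OF amp_has_derivative])
      (auto simp: upper_iff intro!: derivative_eq_intros)
  then show ?thesis by (simp add: mult_ac)
qed

lemma rate_snd_has_derivative: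
  assumes "x \<in> upper"
  shows "((\<lambda>x. rate r (snd x)) has_derivative (\<lambda>v. - (amp r (snd x))\<^sup>2 * snd v)) (at x)"
proof -
  have "((\<lambda>x. rate r (snd x)) has_derivative (\<lambda>v. snd v * (- (amp r (snd x))\<^sup>2))) (at x)"
    using assms by (intro DERIV_compose_FDERIV[OF rate_has_derivative])
      (auto simp: upper_iff intro!: derivative_eq_intros)
  then show ?thesis by (simp add: mult_ac)
qed

lemma y_has_derivative: "((\<lambda>x :: 'n quat \<times> real. fst (fst x) $ l) has_derivative (\<lambda>v. fst (fst v) $ l)) F"
  by (intro bounded_linear_imp_has_derivative bounded_linear_intros
      bounded_linear_compose[OF bounded_linear_vec_nth bounded_linear_compose[OF bounded_linear_fst bounded_linear_fst]])

lemma block_has_derivative: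
  assumes "x \<in> upper"
  shows "((\<lambda>x. block l x s) has_derivative (\<lambda>v. block l x s * block_log v x s l)) (at x)"
proof -
  have eq: "block l x s = (amp (lam l s) (snd x))\<^sup>2 *
      exp (- (1/4 * (fst (fst x) $ l \<bullet> fst (fst x) $ l) * rate (lam l s) (snd x)))" for x
    by (simp add: block_def power2_norm_eq_inner)
  show ?thesis unfolding eq[abs_def]
    by (rule has_derivative_eq_rhs, (rule amp_snd_has_derivative[OF assms] rate_snd_has_derivative[OF assms]
      y_has_derivative has_derivative_mult has_derivative_exp has_derivative_minus has_derivative_inner
      has_derivative_power has_derivative_const)+)
    (simp add: fun_eq_iff block_log_def power2_eq_square inner_commute algebra_simps)
qed

lemma gauss_has_derivative:
  assumes "x \<in> upper"
  shows "((\<lambda>x. gauss x s) has_derivative (\<lambda>v. gauss x s * (\<Sum>l\<in>UNIV. block_log v x s l))) (at x)"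
  unfolding gauss_def[abs_def]
  by (intro has_derivative_prod_log block_has_derivative assms) simp

lemma mode_has_derivative:
  assumes "x \<in> upper"
  shows "((\<lambda>x. mode x s) has_derivative (\<lambda>v. mode x s * log_deriv v x s)) (at x)"
proof -
  have w: "((\<lambda>x :: 'n quat \<times> real. s \<bullet> snd (fst x)) has_derivative (\<lambda>v. s \<bullet> snd (fst v))) (at x)"
    by (auto intro!: derivative_eq_intros)
  have e: "((\<lambda>x :: 'n quat \<times> real. iexp (s \<bullet> snd (fst x))) has_derivative
      (\<lambda>v. (\<i> * of_real (s \<bullet> snd (fst v))) * iexp (s \<bullet> snd (fst x)))) (at x)"
    by (rule has_derivative_eq_rhs, rule has_derivative_compose[OF has_derivative_mult_right[OF
          has_derivative_of_real[OF w]] DERIV_exp[unfolded has_field_derivative_def]]) (simp add: mult_ac)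
  show ?thesis unfolding mode_def[abs_def]
    by (rule has_derivative_eq_rhs, rule has_derivative_mult[OF has_derivative_of_real[OF gauss_has_derivative[OF assms]] e])
      (simp add: fun_eq_iff log_deriv_def of_real_sum algebra_simps)
qed

lemma log_deriv_has_derivative:
  assumes "x \<in> upper"
  shows "((\<lambda>x. log_deriv v x s) has_derivative (\<lambda>u. log_deriv2 u v x s)) (at x)"
proof -
  have "((\<lambda>x. block_log v x s l) has_derivative (\<lambda>u. block_log2 u v x s l)) (at x)" for l
    unfolding block_log_def[abs_def]
    by (rule derivative_eq_intros amp_snd_has_derivative[OF assms] rate_snd_has_derivative[OF assms]
      y_has_derivative refl)+
     (simp add: fun_eq_iff block_log2_def power2_eq_square inner_commute algebra_simps)
  then show ?thesis unfolding log_deriv_def[abs_def] log_deriv2_def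
    by (auto intro!: derivative_eq_intros has_derivative_of_real)
qed

section \<open>Differentiation under the frequency integral\<close>

lemma amp_measurable [measurable]: "(\<lambda>s. amp (lam l s) t) \<in> borel_measurable borel"
  unfolding amp_def sinh_field_def by measurable

lemma rate_measurable [measurable]: "(\<lambda>s. rate (lam l s) t) \<in> borel_measurable borel"
  unfolding rate_def sinh_field_def cosh_field_def by measurable

lemma upper_ball_half:
  assumes x: "x \<in> upper" and x': "x' \<in> ball x (snd x / 2)"
  shows "snd x / 2 \<le> snd x'"
proof -
  have "dist (snd x) (snd x') < snd x / 2"
    using dist_snd_le[of x x'] x' by simp
  then show ?thesis unfolding dist_real_def by linarith
qed

lemma moderate_amp: "moderate upper (\<lambda>x s. of_real (amp (lam l s) (snd x)))"
  unfolding moderate_def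
proof (intro conjI ballI allI)
  fix x :: "'n quat \<times> real" assume x: "x \<in> upper"
  have pos: "snd x > 0" using x by (simp add: upper_iff)
  have "norm (complex_of_real (amp (lam l s) (snd x'))) \<le> 2 / snd x * (1 + norm s) ^ 0"
    if "x' \<in> ball x (snd x / 2) \<inter> upper" for x' s
  proof -
    have x': "snd x / 2 \<le> snd x'" "snd x' > 0" using upper_ball_half[OF x, of x'] that upper_iff by auto
    have "amp (lam l s) (snd x') \<le> 1 / snd x'"
      using amp_le_inverse[of "lam l s" "snd x'"] x' by (simp add: field_simps)
    also have "\<dots> \<le> 2 / snd x" using x' pos by (simp add: field_simps)
    finally show ?thesis using amp_nonneg[of "lam l s" "snd x'"] x' by simp
  qed
  then show "\<exists>e>0. \<exists>K k. \<forall>x'\<in>ball x e \<inter> upper. \<forall>s. norm (complex_of_real (amp (lam l s) (snd x'))) \<le> K * (1 + norm s) ^ k"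
    using pos by (intro exI[of _ "snd x / 2"] conjI exI[of _ "2 / snd x"] exI[of _ 0]) auto
next
  show "continuous_on upper (\<lambda>x. complex_of_real (amp (lam l s) (snd x)))" for s
    using has_derivative_continuous[OF has_derivative_of_real[OF amp_snd_has_derivative]]
    by (intro continuous_at_imp_continuous_on) blast
qed measurable

lemma moderate_rate: "moderate upper (\<lambda>x s. of_real (rate (lam l s) (snd x)))"
  unfolding moderate_def
proof (intro conjI ballI allI)
  fix x :: "'n quat \<times> real" assume x: "x \<in> upper"
  have pos: "snd x > 0" using x by (simp add: upper_iff)
  define K where "K = (\<Sum>m\<in>UNIV. a m l) + 2 / snd x"
  have "norm (complex_of_real (rate (lam l s) (snd x'))) \<le> K * (1 + norm s) ^ 1"
    if "x' \<in> ball x (snd x / 2) \<inter> upper" for x' s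
  proof -
    have x': "snd x / 2 \<le> snd x'" "snd x' > 0" using upper_ball_half[OF x, of x'] that upper_iff by auto
    have "rate (lam l s) (snd x') \<le> lam l s + 1 / snd x'" using rate_le x' by simp
    also have "\<dots> \<le> (\<Sum>m\<in>UNIV. a m l) * norm s + 2 / snd x"
      using x' pos lam_le[of l s] by (intro add_mono) (auto simp: field_simps)
    also have "\<dots> \<le> K * (1 + norm s)"
    proof -
      have "0 \<le> (\<Sum>m\<in>UNIV. a m l)" using a_pos by (intro sum_nonneg) (simp add: less_imp_le)
      moreover have "0 \<le> 2 / snd x * norm s" using pos by simp
      ultimately show ?thesis unfolding K_def distrib_left distrib_right mult_1_right by linarith
    qed
    finally show ?thesis using rate_nonneg[of "lam l s" "snd x'"] x' by simp
  qed
  then show "\<exists>e>0. \<exists>K k. \<forall>x'\<in>ball x e \<inter> upper. \<forall>s. norm (complex_of_real (rate (lam l s) (snd x'))) \<le> K * (1 + norm s) ^ k"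
    using pos by (intro exI[of _ "snd x / 2"] conjI exI[of _ K] exI[of _ 1]) auto
next
  show "continuous_on upper (\<lambda>x. complex_of_real (rate (lam l s) (snd x)))" for s
    using has_derivative_continuous[OF has_derivative_of_real[OF rate_snd_has_derivative]]
    by (intro continuous_at_imp_continuous_on) blast
qed measurable

lemma moderate_inner: "moderate S (\<lambda>x s. of_real (s \<bullet> c))"
  by (rule moderate_of_frequency[where K="norm c" and k=1])
    (auto intro: order_trans[OF Cauchy_Schwarz_ineq2] simp: algebra_simps)

lemma moderate_log_deriv: "moderate upper (log_deriv v)"
proof -
  have "moderate upper (\<lambda>x s. log_deriv v x s)"
    unfolding log_deriv_def block_log_def of_real_add of_real_diff of_real_mult of_real_power power2_eq_square
    by (intro moderate_intros moderate_amp moderate_rate moderate_inner moderate_of_parameter continuous_intros)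
  then show ?thesis by simp
qed

lemma moderate_log_deriv2: "moderate upper (log_deriv2 u v)"
proof -
  have "moderate upper (\<lambda>x s. log_deriv2 u v x s)"
    unfolding log_deriv2_def block_log2_def of_real_add of_real_diff of_real_mult of_real_power power2_eq_square
    by (intro moderate_intros moderate_amp moderate_rate moderate_inner moderate_of_parameter continuous_intros)
  then show ?thesis by simp
qed

lemma block_nonneg: "0 \<le> block l x s"
  by (simp add: block_def)

lemma gauss_nonneg: "0 \<le> gauss x s"
  unfolding gauss_def by (intro prod_nonneg ballI block_nonneg)

lemma norm_mode: "norm (mode x s) = gauss x s"
  by (simp add: mode_def norm_mult gauss_nonneg)

lemma mode_measurable [measurable]: "mode x \<in> borel_measurable borel"
  unfolding mode_def[abs_def] gauss_def block_def by measurable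

text \<open>
  Each factor \<open>amp\<^sup>2\<close> contributes exponential decay; since there is at least one block, the product
  decays at least as fast as one factor. The constants depend only on a lower bound for the time.
\<close>

lemma gauss_bound:
  assumes "d > 0"
  obtains c K where "c > 0" "K \<ge> 0" "\<And>x s. d \<le> snd x \<Longrightarrow> gauss x s \<le> K * exp (- (c * norm s))"
proof -
  obtain c where c: "c > 0" "\<And>l s. c * norm s \<le> lam l s" using lam_ge by blast
  have bl: "block l x s \<le> (2 / d)\<^sup>2 * exp (- (c * d * norm s))" if x: "d \<le> snd x" for l x s
  proof -
    have t: "snd x > 0" using assms x by simp
    have "c * norm s * d \<le> lam l s * snd x"
      using c(2)[of s l] x assms by (intro mult_mono) auto
    then have e: "exp (- (lam l s * snd x / 2)) \<le> exp (- (c * d * norm s / 2))"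
      by (simp add: mult_ac)
    have "amp (lam l s) (snd x) \<le> 2 / snd x * exp (- (lam l s * snd x / 2))"
      using t by (intro amp_le_exp) auto
    also have "\<dots> \<le> 2 / d * exp (- (c * d * norm s / 2))"
      using x assms t e by (intro mult_mono) (auto simp: field_simps)
    finally have "(amp (lam l s) (snd x))\<^sup>2 \<le> (2 / d * exp (- (c * d * norm s / 2)))\<^sup>2"
      using amp_nonneg[of "lam l s" "snd x"] t by (intro power_mono) auto
    also have "\<dots> = (2 / d)\<^sup>2 * exp (- (c * d * norm s))"
      by (simp add: power_mult_distrib power_divide flip: exp_double)
    finally have am: "(amp (lam l s) (snd x))\<^sup>2 \<le> (2 / d)\<^sup>2 * exp (- (c * d * norm s))" .
    have "block l x s \<le> (amp (lam l s) (snd x))\<^sup>2 * 1"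
      unfolding block_def using rate_nonneg[of "lam l s" "snd x"] t by (intro mult_left_mono) auto
    with am show ?thesis by simp
  qed
  show thesis
  proof (rule that[of "c * d" "((2 / d)\<^sup>2) ^ CARD('n)"])
    fix x :: "'n quat \<times> real" and s assume x: "d \<le> snd x"
    have "gauss x s \<le> (\<Prod>l\<in>(UNIV::'n set). (2 / d)\<^sup>2 * exp (- (c * d * norm s)))"
      unfolding gauss_def using bl[OF x] block_nonneg by (intro prod_mono) auto
    also have "\<dots> = ((2 / d)\<^sup>2) ^ CARD('n) * exp (- (c * d * norm s)) ^ CARD('n)"
      by (simp add: power_mult_distrib)
    also have "exp (- (c * d * norm s)) ^ CARD('n) \<le> exp (- (c * d * norm s)) ^ 1"
      using c assms by (intro power_decreasing) (auto simp: Suc_le_eq)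
    finally show "gauss x s \<le> ((2 / d)\<^sup>2) ^ CARD('n) * exp (- (c * d * norm s))"
      by (simp add: mult_left_mono)
  qed (use c assms in auto)
qed

lemma mode_dominated:
  assumes "moderate upper T"
  shows "locally_dominated upper lborel (\<lambda>x s. mode x s * T x s)"
  unfolding locally_dominated_def
proof
  fix x :: "'n quat \<times> real" assume x: "x \<in> upper"
  then have pos: "snd x / 2 > 0" by (simp add: upper_iff)
  obtain e K k where e: "e > 0" "K \<ge> 0"
    "\<And>x' s. x' \<in> ball x e \<inter> upper \<Longrightarrow> norm (T x' s) \<le> K * (1 + norm s) ^ k"
    using moderate_boundE[OF assms x] by blast
  obtain c J where c: "c > 0" "J \<ge> 0"
    "\<And>x' s. snd x / 2 \<le> snd x' \<Longrightarrow> gauss x' s \<le> J * exp (- (c * norm s))"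
    using gauss_bound[OF pos] by blast
  have "norm (mode x' s * T x' s) \<le> (J * K) * ((1 + norm s) ^ k * exp (- (c * norm s)))"
    if "x' \<in> ball x (min e (snd x / 2)) \<inter> upper" for x' s
  proof -
    have "gauss x' s * norm (T x' s) \<le> (J * exp (- (c * norm s))) * (K * (1 + norm s) ^ k)"
      using that upper_ball_half[OF x, of x'] c(2) by (intro mult_mono c(3) e(3)) auto
    then show ?thesis by (simp add: norm_mult norm_mode mult_ac)
  qed
  moreover have "integrable lborel (\<lambda>s::real^3. (J * K) * ((1 + norm s) ^ k * exp (- (c * norm s))))"
    by (intro integrable_mult_right integrable_power_mult_exp c)
  ultimately show "\<exists>e>0. \<exists>B. integrable lborel B \<and> (\<forall>x'\<in>ball x e \<inter> upper. \<forall>s. norm (mode x' s * T x' s) \<le> B s)"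
    using e(1) pos by (intro exI[of _ "min e (snd x / 2)"] conjI
      exI[of _ "\<lambda>s. (J * K) * ((1 + norm s) ^ k * exp (- (c * norm s)))"]) auto
qed

lemma mode_T_measurable: "moderate upper T \<Longrightarrow> x \<in> upper \<Longrightarrow> (\<lambda>s. mode x s * T x s) \<in> borel_measurable borel"
  by (intro borel_measurable_times mode_measurable) (auto simp: moderate_def)

lemma integrable_mode:
  assumes "moderate upper T" "x \<in> upper"
  shows "integrable lborel (\<lambda>s. mode x s * T x s)"
  using locally_dominated_integrable[OF mode_dominated[OF assms(1)] assms(2)] mode_T_measurable[OF assms] by simp

lemma continuous_integral_mode:
  assumes "moderate upper T"
  shows "continuous_on upper (\<lambda>x. \<integral>s. mode x s * T x s \<partial>lborel)"
proof (rule continuous_on_integral_param[OF mode_dominated[OF assms] open_upper])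
  have "continuous_on upper (\<lambda>x. mode x s)" for s
    using has_derivative_continuous[OF mode_has_derivative]
    by (intro continuous_at_imp_continuous_on) blast
  then show "continuous_on upper (\<lambda>x. mode x s * T x s)" for s
    using assms by (intro continuous_on_mult) (auto simp: moderate_def)
qed (use mode_T_measurable[OF assms] in auto)

text \<open>
  Exponential decay of the mode beats the polynomial growth of its moderate coefficients, and the
  derivative of a mode times a moderate coefficient is again of this form. This closure property
  gives all the derivatives needed below.
\<close>

lemma integral_mode_has_derivative:
  assumes T: "moderate upper T" and T': "\<And>v. moderate upper (T' v)"
    and der: "\<And>x s. x \<in> upper \<Longrightarrow> ((\<lambda>x. T x s) has_derivative (\<lambda>v. T' v x s)) (at x)"
    and x: "x \<in> upper"
  shows "((\<lambda>x. \<integral>s. mode x s * T x s \<partial>lborel) has_derivative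
    (\<lambda>v. \<integral>s. mode x s * (log_deriv v x s * T x s + T' v x s) \<partial>lborel)) (at x)"
proof (rule has_derivative_integral_param[OF open_upper x])
  have M: "moderate upper (\<lambda>x s. log_deriv v x s * T x s + T' v x s)" for v
    by (intro moderate_add moderate_mult T T' moderate_log_deriv)
  show "locally_dominated upper lborel (\<lambda>x s. mode x s * (log_deriv v x s * T x s + T' v x s))" for v
    by (intro mode_dominated M)
  show "(\<lambda>s. mode x s * (log_deriv v x s * T x s + T' v x s)) \<in> borel_measurable lborel" if "x \<in> upper" for x v
    using mode_T_measurable[OF M that] by simp
  show "((\<lambda>x. mode x s * T x s) has_derivative (\<lambda>v. mode x s * (log_deriv v x s * T x s + T' v x s))) (at x)"
    if "x \<in> upper" for x s
    by (rule has_derivative_eq_rhs, rule has_derivative_mult[OF mode_has_derivative[OF that] der[OF that]])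
      (simp add: fun_eq_iff algebra_simps)
qed (use integrable_mode[OF T] in auto)

lemma Ck_on_integral_mode: "Ck_on 2 (\<lambda>x. \<integral>s. mode x s \<partial>lborel) upper"
  unfolding numeral_2_eq_2
proof (intro Ck_on_SucI[OF open_upper])
  show "((\<lambda>x. \<integral>s. mode x s \<partial>lborel) has_derivative (\<lambda>v. \<integral>s. mode x s * log_deriv v x s \<partial>lborel)) (at x)"
    if "x \<in> upper" for x
    using integral_mode_has_derivative[of "\<lambda>_ _. 1" "\<lambda>_ _ _. 0" x] that by (simp add: moderate_const)
  show "((\<lambda>x. \<integral>s. mode x s * log_deriv v x s \<partial>lborel) has_derivative
      (\<lambda>u. \<integral>s. mode x s * (log_deriv u x s * log_deriv v x s + log_deriv2 u v x s) \<partial>lborel)) (at x)"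
    if "x \<in> upper" for x v
    by (intro integral_mode_has_derivative moderate_log_deriv moderate_log_deriv2 log_deriv_has_derivative that)
  show "Ck_on 0 (\<lambda>x. \<integral>s. mode x s * (log_deriv u x s * log_deriv v x s + log_deriv2 u v x s) \<partial>lborel) upper" for u v
    unfolding Ck_on.simps
    by (intro continuous_integral_mode moderate_add moderate_mult moderate_log_deriv moderate_log_deriv2)
qed

section \<open>The horizontal fields on the Fourier side\<close>

text \<open>
  The vertical component of the horizontal field: \<open>Y\<^sub>k\<^sub>l\<close> at \<open>p\<close> is the derivative in the direction
  \<open>(e\<^sub>k\<^sub>l, twist k l p)\<close>.
\<close>

definition twist :: "4 \<Rightarrow> 'n \<Rightarrow> 'n quat \<Rightarrow> real^3" where
  "twist k l p = (\<chi> m. 1/2 * (blockM a m (fst p) $ l $ k))"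

lemma horizontal_field_eq_derivative:
  assumes "(F has_derivative D) (at p)"
  shows "horizontal_field a k l F p = D (axis l (axis k 1), twist k l p)"
proof -
  interpret D: bounded_linear D using assms by (rule has_derivative_bounded_linear)
  let ?b = "twist k l p" and ?e = "axis l (axis k 1) :: real^4^'n"
  have fd: "frechet_derivative F (at p) = D" using frechet_derivative_at[OF assms] by simp
  have "?b = (\<Sum>m\<in>UNIV. (?b $ m) *\<^sub>R axis m 1)"
    using basis_expansion[of ?b] by (simp add: scalar_mult_eq_scaleR)
  then have "(?e, ?b) = (?e, 0) + (\<Sum>m\<in>UNIV. (?b $ m) *\<^sub>R (0, axis m 1))"
    by (auto intro!: prod_eqI simp: fst_sum snd_sum)
  then have "D (?e, ?b) = D (?e, 0) + (\<Sum>m\<in>UNIV. (?b $ m) *\<^sub>R D (0, axis m 1))"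
    by (simp only: D.add D.sum D.scaleR)
  then show ?thesis
    by (simp add: horizontal_field_def dY_def dW_def fd twist_def scaleR_conv_of_real sum_distrib_left)
qed

lemma blockM_linear: "linear (blockM a m)"
  by (rule linearI) (simp_all add: blockM_def vec_eq_iff matrix_vector_right_distrib matrix_vector_mult_scaleR)

lemma twist_linear: "bounded_linear (twist k l)"
  unfolding linear_conv_bounded_linear[symmetric]
  by (rule linearI)
    (simp_all add: twist_def vec_eq_iff linear_add[OF blockM_linear] linear_scale[OF blockM_linear] algebra_simps)

lemma calM_diagonal: "calM m $ k $ k = 0"
  using exhaust_4[of k] by (auto simp: calM_def vector_def)

text \<open>
  The matrices have zero diagonal, so the vertical component of \<open>Y\<^sub>k\<^sub>l\<close> does not change along
  \<open>Y\<^sub>k\<^sub>l\<close>. Hence \<open>Y\<^sub>k\<^sub>l\<^sup>2\<close> contains no first order derivative in the vertical variables.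
\<close>

lemma twist_self: "twist k l (axis l (axis k 1), w) = 0"
  by (simp add: twist_def blockM_def vec_eq_iff matrix_vector_mult_basis column_def calM_diagonal)

text \<open>
  The factor by which \<open>Y\<^sub>k\<^sub>l\<close> multiplies a mode.
\<close>

definition hsymbol :: "4 \<Rightarrow> 'n \<Rightarrow> 'n quat \<times> real \<Rightarrow> real^3 \<Rightarrow> complex" where
  "hsymbol k l x s = \<i> * of_real (s \<bullet> twist k l (fst x)) - of_real (1/2 * (fst (fst x) $ l $ k) * rate (lam l s) (snd x))"

definition hsymbol_deriv :: "4 \<Rightarrow> 'n \<Rightarrow> 'n quat \<times> real \<Rightarrow> 'n quat \<times> real \<Rightarrow> real^3 \<Rightarrow> complex" where
  "hsymbol_deriv k l v x s = \<i> * of_real (s \<bullet> twist k l (fst v))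
     - of_real (1/2 * (fst (fst v) $ l $ k) * rate (lam l s) (snd x))
     + of_real (1/2 * (fst (fst x) $ l $ k) * (amp (lam l s) (snd x))\<^sup>2 * snd v)"

lemma log_deriv_horizontal:
  "log_deriv ((axis l (axis k 1), twist k l (fst x)), 0) x s = hsymbol k l x s"
proof -
  have "block_log ((axis l (axis k 1), b), 0) x s l' =
      (if l' = l then - 1/2 * (fst (fst x) $ l $ k) * rate (lam l s) (snd x) else 0)" for b l'
    by (simp add: block_log_def axis_def[of l] inner_axis)
  then show ?thesis by (simp add: log_deriv_def hsymbol_def flip: of_real_sum)
qed

lemma moderate_component: "moderate S (\<lambda>x s::real^3. of_real (s $ i))"
  using moderate_inner[of S "axis i 1 :: real^3"] by (simp add: inner_axis)

lemma moderate_hsymbol: "moderate upper (hsymbol k l)"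
proof -
  have "moderate upper (\<lambda>x s. hsymbol k l x s)"
    unfolding hsymbol_def of_real_mult inner_vec_def of_real_sum inner_real_def
    by (intro moderate_intros moderate_rate moderate_of_parameter continuous_intros moderate_component
        bounded_linear.continuous_on[OF twist_linear])
  then show ?thesis by simp
qed

lemma moderate_hsymbol_deriv: "moderate upper (hsymbol_deriv k l v)"
proof -
  have "moderate upper (\<lambda>x s. hsymbol_deriv k l v x s)"
    unfolding hsymbol_deriv_def of_real_mult power2_eq_square
    by (intro moderate_intros moderate_rate moderate_amp moderate_of_parameter continuous_intros moderate_inner)
  then show ?thesis by simp
qed

lemma hsymbol_has_derivative:
  assumes "x \<in> upper"
  shows "((\<lambda>x. hsymbol k l x s) has_derivative (\<lambda>v. hsymbol_deriv k l v x s)) (at x)"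
proof -
  have w: "((\<lambda>x. s \<bullet> twist k l (fst x)) has_derivative (\<lambda>v. s \<bullet> twist k l (fst v))) (at x)"
    by (intro has_derivative_inner_right bounded_linear.has_derivative[OF twist_linear] has_derivative_fst has_derivative_ident)
  have y: "((\<lambda>x. fst (fst x) $ l $ k) has_derivative (\<lambda>v. fst (fst v) $ l $ k)) (at x)"
    by (rule bounded_linear.has_derivative[OF bounded_linear_vec_nth y_has_derivative])
  have r: "((\<lambda>x. 1/2 * (fst (fst x) $ l $ k) * rate (lam l s) (snd x)) has_derivative
     (\<lambda>v. 1/2 * (fst (fst v) $ l $ k) * rate (lam l s) (snd x)
         - 1/2 * (fst (fst x) $ l $ k) * (amp (lam l s) (snd x))\<^sup>2 * snd v)) (at x)"
    by (rule has_derivative_eq_rhs, rule has_derivative_mult[OF has_derivative_mult_right[OF y]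
        rate_snd_has_derivative[OF assms]]) (simp add: fun_eq_iff)
  show ?thesis unfolding hsymbol_def[abs_def]
    by (rule has_derivative_eq_rhs, rule has_derivative_diff[OF has_derivative_mult_right[OF
          has_derivative_of_real[OF w]] has_derivative_of_real[OF r]])
      (simp add: fun_eq_iff hsymbol_deriv_def)
qed

lemma horizontal_field_integral_mode:
  assumes "moderate upper T" "\<And>v. moderate upper (T' v)"
    "\<And>x s. x \<in> upper \<Longrightarrow> ((\<lambda>x. T x s) has_derivative (\<lambda>v. T' v x s)) (at x)" "t > 0"
  shows "horizontal_field a k l (\<lambda>q. \<integral>s. mode (q, t) s * T (q, t) s \<partial>lborel) p =
    (\<integral>s. mode (p, t) s * (hsymbol k l (p, t) s * T (p, t) s
       + T' ((axis l (axis k 1), twist k l p), 0) (p, t) s) \<partial>lborel)"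
proof -
  have pt: "(p, t) \<in> upper" using assms(4) by (simp add: upper_iff)
  have "((\<lambda>q. (q, t)) has_derivative (\<lambda>u. (u, 0))) (at p)"
    by (intro has_derivative_Pair has_derivative_ident has_derivative_const)
  from has_derivative_compose[OF this integral_mode_has_derivative[OF assms(1-3) pt]]
  show ?thesis
    using log_deriv_horizontal[of l k "(p, t)"] by (simp add: horizontal_field_eq_derivative)
qed

lemma calM_mult_vec:
  fixes v :: "real^4"
  shows "(calM 1 *v v) $ 1 = v $ 2" "(calM 1 *v v) $ 2 = - v $ 1" "(calM 1 *v v) $ 3 = v $ 4" "(calM 1 *v v) $ 4 = - v $ 3"
    "(calM 2 *v v) $ 1 = - v $ 4" "(calM 2 *v v) $ 2 = - v $ 3" "(calM 2 *v v) $ 3 = v $ 2" "(calM 2 *v v) $ 4 = v $ 1"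
    "(calM 3 *v v) $ 1 = - v $ 3" "(calM 3 *v v) $ 2 = v $ 4" "(calM 3 *v v) $ 3 = v $ 1" "(calM 3 *v v) $ 4 = - v $ 2"
  by (simp_all add: calM_def matrix_vector_mult_def sum_4 vector_def)

lemma inner_twist: "s \<bullet> twist k l p = (\<Sum>m\<in>UNIV. 1/2 * (s $ m * a m l) * (calM m *v (fst p $ l)) $ k)"
  by (simp add: inner_vec_def twist_def blockM_def scaleR_matrix_vector_assoc[symmetric] mult_ac)

text \<open>
  The anticommutation relations of the three matrices: the mixed terms in the frequency cancel.
\<close>

lemma sum_inner_twist_sq:
  "(\<Sum>k\<in>UNIV. (s \<bullet> twist k l p)\<^sup>2) = 1/4 * (lam l s)\<^sup>2 * (fst p $ l \<bullet> fst p $ l)"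
  unfolding inner_twist unfolding lam_sq inner_vec_def sum_3 sum_4 inner_real_def calM_mult_vec
  by (simp add: power2_eq_square algebra_simps)

text \<open>
  Skew symmetry of the three matrices.
\<close>

lemma sum_inner_twist_mult: "(\<Sum>k\<in>UNIV. (s \<bullet> twist k l p) * (fst p $ l $ k)) = 0"
  unfolding inner_twist sum_3 sum_4 calM_mult_vec
  by (simp add: algebra_simps)

text \<open>
  The heat equation for a single mode, block by block. The squares of the symbols add up to
  \<open>|y\<^sub>l|\<^sup>2 (rate\<^sup>2 - r\<^sup>2) / 4 = |y\<^sub>l|\<^sup>2 amp\<^sup>2 / 4\<close>, their mixed terms cancel, and the four derivatives of
  \<open>- rate y\<^sub>k\<^sub>l / 2\<close> add up to \<open>- 2 rate\<close>; the total is the logarithmic derivative of the block in time.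
\<close>

lemma sum_hsymbol_sq:
  assumes "t > 0"
  shows "(\<Sum>k\<in>UNIV. (hsymbol k l (p, t) s)\<^sup>2 + hsymbol_deriv k l ((axis l (axis k 1), twist k l p), 0) (p, t) s)
    = of_real (block_log (0, 1) (p, t) s l)"
proof -
  let ?B = "rate (lam l s) t" and ?y = "fst p $ l"
  have "(hsymbol k l (p, t) s)\<^sup>2 + hsymbol_deriv k l ((axis l (axis k 1), twist k l p), 0) (p, t) s =
      of_real (- (s \<bullet> twist k l p)\<^sup>2 + 1/4 * (?y $ k * ?y $ k) * ?B\<^sup>2 - 1/2 * ?B)
      - \<i> * of_real (?B * ((s \<bullet> twist k l p) * (?y $ k)))" for k
    by (simp add: hsymbol_def hsymbol_deriv_def twist_self power2_eq_square algebra_simps)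
  then have "(\<Sum>k\<in>UNIV. (hsymbol k l (p, t) s)\<^sup>2 + hsymbol_deriv k l ((axis l (axis k 1), twist k l p), 0) (p, t) s)
     = of_real (- (\<Sum>k\<in>UNIV. (s \<bullet> twist k l p)\<^sup>2) + 1/4 * (\<Sum>k\<in>UNIV. ?y $ k * ?y $ k) * ?B\<^sup>2 - 2 * ?B)
      - \<i> * of_real (?B * (\<Sum>k\<in>UNIV. (s \<bullet> twist k l p) * (?y $ k)))"
    by (simp add: sum_subtractf sum.distrib sum_negf sum_distrib_left sum_distrib_right)
  also have "\<dots> = of_real (1/4 * (?y \<bullet> ?y) * (?B\<^sup>2 - (lam l s)\<^sup>2) - 2 * ?B)"
    unfolding sum_inner_twist_sq sum_inner_twist_mult by (simp add: inner_vec_def algebra_simps)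
  also have "\<dots> = of_real (block_log (0, 1) (p, t) s l)"
    using rate_sq[OF assms] by (simp add: block_log_def)
  finally show ?thesis .
qed

section \<open>The heat equation\<close>

definition kernel :: "'n quat \<Rightarrow> real \<Rightarrow> complex" where
  "kernel p t = (\<integral>s. mode (p, t) s * of_real (1 / ((2 * pi) ^ 3 * (4 * pi) ^ (2 * CARD('n)))) \<partial>lborel)"

lemma kernel_heat_equation:
  assumes t: "t > 0"
  shows "sublaplacian a (\<lambda>q. kernel q t) p = vector_derivative (kernel p) (at t)"
proof -
  define C where "C = complex_of_real (1 / ((2 * pi) ^ 3 * (4 * pi) ^ (2 * CARD('n))))"
  have pt: "(p, t) \<in> upper" using t by (simp add: upper_iff)
  have kernel: "kernel q t = (\<integral>s. mode (q, t) s * C \<partial>lborel)" for q t by (simp add: kernel_def C_def)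
  have MC: "moderate upper (\<lambda>_ _. C)" "moderate upper (\<lambda>_ _. 0)" by (rule moderate_const)+
  have first: "horizontal_field a k l (\<lambda>q. kernel q t) = (\<lambda>q. \<integral>s. mode (q, t) s * (hsymbol k l (q, t) s * C) \<partial>lborel)" for k l
    unfolding kernel
    by (rule ext, subst horizontal_field_integral_mode[where T'="\<lambda>_ _ _. 0"]) (auto intro: MC t)
  have second: "horizontal_field a k l (horizontal_field a k l (\<lambda>q. kernel q t)) p =
      (\<integral>s. mode (p, t) s * (((hsymbol k l (p, t) s)\<^sup>2
         + hsymbol_deriv k l ((axis l (axis k 1), twist k l p), 0) (p, t) s) * C) \<partial>lborel)" for k l
    unfolding first
    by (subst horizontal_field_integral_mode[where T'="\<lambda>v x s. hsymbol_deriv k l v x s * C"])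
      (auto intro!: t moderate_mult moderate_const moderate_hsymbol moderate_hsymbol_deriv
        has_derivative_mult_left hsymbol_has_derivative simp: power2_eq_square distrib_right mult.assoc)
  have "sublaplacian a (\<lambda>q. kernel q t) p = (\<Sum>l\<in>UNIV. \<Sum>k\<in>UNIV.
      \<integral>s. mode (p, t) s * (((hsymbol k l (p, t) s)\<^sup>2
         + hsymbol_deriv k l ((axis l (axis k 1), twist k l p), 0) (p, t) s) * C) \<partial>lborel)"
    unfolding sublaplacian_def second ..
  also have "\<dots> = (\<integral>s. (\<Sum>l\<in>UNIV. \<Sum>k\<in>UNIV. mode (p, t) s * (((hsymbol k l (p, t) s)\<^sup>2
         + hsymbol_deriv k l ((axis l (axis k 1), twist k l p), 0) (p, t) s) * C)) \<partial>lborel)"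
  proof -
    have "moderate upper (\<lambda>x s. (hsymbol k l x s * hsymbol k l x s + hsymbol_deriv k l v x s) * C)" for k l v
      by (intro moderate_intros moderate_hsymbol moderate_hsymbol_deriv)
    from integrable_mode[OF this pt] show ?thesis
      by (simp add: power2_eq_square Bochner_Integration.integral_sum Bochner_Integration.integrable_sum)
  qed
  also have "\<dots> = (\<integral>s. mode (p, t) s * (log_deriv (0, 1) (p, t) s * C) \<partial>lborel)"
    unfolding sum_distrib_left[symmetric] sum_distrib_right[symmetric] sum_hsymbol_sq[OF t]
    by (simp add: log_deriv_def)
  also have "\<dots> = vector_derivative (kernel p) (at t)"
  proof -
    have "((\<lambda>t. (p, t)) has_derivative (\<lambda>u. (0, u))) (at t)"
      by (intro has_derivative_Pair has_derivative_ident has_derivative_const)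
    from has_derivative_compose[OF this integral_mode_has_derivative[OF MC(1) MC(2) _ pt]]
    have D: "(kernel p has_derivative (\<lambda>u. \<integral>s. mode (p, t) s * (log_deriv (0, u) (p, t) s * C) \<partial>lborel)) (at t)"
      by (simp add: kernel[abs_def])
    have ld: "log_deriv (0, u) (p, t) s = of_real u * log_deriv (0, 1) (p, t) s" for u s
      by (simp add: log_deriv_def block_log_def sum_distrib_left algebra_simps)
    have eq: "mode (p, t) s * (log_deriv (0, u) (p, t) s * C) =
        of_real u * (mode (p, t) s * (log_deriv (0, 1) (p, t) s * C))" for u s
      by (subst ld) simp
    have "(\<lambda>u. \<integral>s. mode (p, t) s * (log_deriv (0, u) (p, t) s * C) \<partial>lborel) =
        (\<lambda>u. u *\<^sub>R (\<integral>s. mode (p, t) s * (log_deriv (0, 1) (p, t) s * C) \<partial>lborel))"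
      by (subst eq) (simp only: integral_mult_right_zero scaleR_conv_of_real)
    with D show ?thesis
      by (intro vector_derivative_at[symmetric]) (simp add: has_vector_derivative_def)
  qed
  finally show ?thesis .
qed

section \<open>The initial value\<close>

text \<open>
  The Gaussian factor of a mode after the parabolic scaling \<open>y = \<surd>t u\<close>, including the Jacobian
  \<open>t\<^bsup>2n\<^esup>\<close>.
\<close>

definition scaled_gauss :: "real \<Rightarrow> real^4^'n \<Rightarrow> real^3 \<Rightarrow> real" where
  "scaled_gauss t u s =
     (\<Prod>l\<in>UNIV. (t * amp (lam l s) t)\<^sup>2 * exp (- ((norm (u $ l))\<^sup>2 / 4 * (t * rate (lam l s) t))))"

lemma gauss_eq_scaled:
  assumes t: "t > 0"
  shows "t ^ (2 * CARD('n)) * gauss ((sqrt t *\<^sub>R u, w), t) s = scaled_gauss t u s"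
proof -
  have "t ^ (2 * CARD('n)) = (\<Prod>l\<in>(UNIV::'n set). t\<^sup>2)" by (simp add: power_mult)
  then have "t ^ (2 * CARD('n)) * gauss ((sqrt t *\<^sub>R u, w), t) s =
     (\<Prod>l\<in>UNIV. t\<^sup>2 * block l ((sqrt t *\<^sub>R u, w), t) s)"
    by (simp add: gauss_def prod.distrib)
  also have "\<dots> = scaled_gauss t u s"
    unfolding scaled_gauss_def
    using t by (intro prod.cong refl) (simp add: block_def power_mult_distrib mult_ac)
  finally show ?thesis .
qed

lemma sum_norm_sq_blocks: "(\<Sum>l\<in>UNIV. (norm (u $ l))\<^sup>2) = (norm (u :: real^4^'n))\<^sup>2"
  by (simp add: norm_vec_def L2_set_def sum_nonneg)

lemma scaled_gauss_nonneg: "0 \<le> scaled_gauss t u s"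
  unfolding scaled_gauss_def by (intro prod_nonneg) auto

text \<open>
  Both \<open>u / sinh u \<le> 1\<close> and \<open>1 \<le> u coth u\<close> hold for \<open>u > 0\<close>, so the bound is uniform in the time and
  in the frequency.
\<close>

lemma scaled_gauss_le:
  assumes t: "t > 0" and s: "s \<noteq> 0"
  shows "scaled_gauss t u s \<le> exp (- (1/4) * (norm u)\<^sup>2)"
proof -
  have "scaled_gauss t u s \<le> (\<Prod>l\<in>UNIV. 1 * exp (- ((norm (u $ l))\<^sup>2 / 4 * 1)))"
    unfolding scaled_gauss_def
  proof (intro prod_mono conjI)
    fix l :: 'n
    have r: "lam l s > 0" using lam_pos[OF s] .
    have "(t * amp (lam l s) t)\<^sup>2 \<le> 1"
      using amp_le_inverse[of "lam l s" t] amp_nonneg[of "lam l s" t] t by (intro power_le_one) auto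
    moreover have "exp (- ((norm (u $ l))\<^sup>2 / 4 * (t * rate (lam l s) t))) \<le> exp (- ((norm (u $ l))\<^sup>2 / 4 * 1))"
      unfolding exp_le_cancel_iff neg_le_iff_le using rate_ge[OF r t] by (intro mult_left_mono) auto
    ultimately show "(t * amp (lam l s) t)\<^sup>2 * exp (- ((norm (u $ l))\<^sup>2 / 4 * (t * rate (lam l s) t)))
        \<le> 1 * exp (- ((norm (u $ l))\<^sup>2 / 4 * 1))"
      by (intro mult_mono) auto
  qed auto
  also have "\<dots> = exp (- (\<Sum>l\<in>UNIV. (norm (u $ l))\<^sup>2) / 4)"
    by (simp add: sum_negf sum_divide_distrib flip: exp_sum)
  finally show ?thesis unfolding sum_norm_sq_blocks by simp
qed

lemma scaled_gauss_tendsto: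
  assumes s: "s \<noteq> 0"
  shows "((\<lambda>t. scaled_gauss t u s) \<longlongrightarrow> exp (- (1/4) * (norm u)\<^sup>2)) (at_right 0)"
proof -
  have "((\<lambda>t. scaled_gauss t u s) \<longlongrightarrow> (\<Prod>l\<in>UNIV. 1\<^sup>2 * exp (- ((norm (u $ l))\<^sup>2 / 4 * 1)))) (at_right 0)"
    unfolding scaled_gauss_def
    by (intro tendsto_intros amp_scaled_tendsto rate_scaled_tendsto lam_pos s)
  also have "(\<Prod>l\<in>UNIV. 1\<^sup>2 * exp (- ((norm (u $ l))\<^sup>2 / 4 * 1))) = exp (- (\<Sum>l\<in>UNIV. (norm (u $ l))\<^sup>2) / 4)"
    by (simp add: sum_negf sum_divide_distrib flip: exp_sum)
  finally show ?thesis unfolding sum_norm_sq_blocks by simp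
qed

lemma mode_measurable_pair [measurable]:
  "(\<lambda>(s, p). mode (p, t) s) \<in> borel_measurable (borel \<Otimes>\<^sub>M borel)"
proof -
  have [measurable]: "(\<lambda>p :: 'n quat. norm (fst p $ l)) \<in> borel_measurable borel" for l
    by (intro borel_measurable_continuous_onI continuous_intros)
  have [measurable]: "(snd :: 'n quat \<Rightarrow> real^3) \<in> borel_measurable borel"
    by (intro borel_measurable_continuous_onI continuous_intros)
  show ?thesis unfolding mode_def gauss_def block_def fst_conv snd_conv by measurable
qed

definition mode_pairing :: "('n quat \<Rightarrow> complex) \<Rightarrow> real \<Rightarrow> real^3 \<Rightarrow> complex" where
  "mode_pairing \<phi> t s = (\<integral>p. mode (p, t) s * \<phi> p \<partial>lborel)"

lemma kernel_pairing:
  assumes \<phi>: "test_function \<phi>" and t: "t > 0"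
  shows "(\<integral>p. kernel p t * \<phi> p \<partial>lborel) =
      of_real (1 / ((2 * pi) ^ 3 * (4 * pi) ^ (2 * CARD('n)))) * integral\<^sup>L lborel (mode_pairing \<phi> t)"
    and "mode_pairing \<phi> t \<in> borel_measurable lborel"
proof -
  let ?C = "complex_of_real (1 / ((2 * pi) ^ 3 * (4 * pi) ^ (2 * CARD('n))))"
  obtain c K where cK: "c > 0" "K \<ge> 0" "\<And>x s. t \<le> snd x \<Longrightarrow> gauss x s \<le> K * exp (- (c * norm s))"
    by (rule gauss_bound[OF t]) (rule that)
  have [measurable]: "\<phi> \<in> borel_measurable borel"
    by (rule borel_measurable_continuous_onI[OF test_function_continuous[OF \<phi>]])
  have m: "(\<lambda>(s, p). mode (p, t) s * \<phi> p) \<in> borel_measurable (lborel \<Otimes>\<^sub>M lborel)" by measurable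
  have int: "integrable (lborel \<Otimes>\<^sub>M lborel) (\<lambda>(s, p). mode (p, t) s * \<phi> p)"
  proof (rule integrable_product_bound[OF m, where h="\<lambda>p. norm (\<phi> p)"])
    show "integrable lborel (\<lambda>s::real^3. K * ((1 + norm s) ^ 0 * exp (- (c * norm s))))"
      by (intro integrable_mult_right integrable_power_mult_exp cK)
    show "integrable lborel (\<lambda>p. norm (\<phi> p))" using test_function_integrable[OF \<phi>] by simp
    show "norm (mode (p, t) s * \<phi> p) \<le> K * ((1 + norm s) ^ 0 * exp (- (c * norm s))) * norm (\<phi> p)" for s p
      using cK(3)[of "(p, t)" s] by (simp add: norm_mult norm_mode mult_right_mono)
  qed
  have "(\<integral>p. kernel p t * \<phi> p \<partial>lborel) = (\<integral>p. ?C * (\<integral>s. mode (p, t) s * \<phi> p \<partial>lborel) \<partial>lborel)"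
    unfolding kernel_def by (simp add: mult_ac)
  also have "\<dots> = ?C * (\<integral>p. (\<integral>s. mode (p, t) s * \<phi> p \<partial>lborel) \<partial>lborel)"
    by (rule integral_mult_right_zero)
  also have "(\<integral>p. (\<integral>s. mode (p, t) s * \<phi> p \<partial>lborel) \<partial>lborel) = integral\<^sup>L lborel (mode_pairing \<phi> t)"
    unfolding mode_pairing_def[abs_def] by (rule lborel_pair.Fubini_integral[OF int])
  finally show "(\<integral>p. kernel p t * \<phi> p \<partial>lborel) = ?C * integral\<^sup>L lborel (mode_pairing \<phi> t)" .
  show "mode_pairing \<phi> t \<in> borel_measurable lborel"
    unfolding mode_pairing_def[abs_def]
    using lborel.borel_measurable_lebesgue_integral[OF m] by simp
qed

lemma mode_pairing_scaled:
  assumes \<phi>: "test_function \<phi>" and t: "t > 0"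
  shows "mode_pairing \<phi> t s =
    (\<integral>u. of_real (scaled_gauss t u s) * partial_fourier \<phi> (sqrt t *\<^sub>R u) s \<partial>lborel)"
proof -
  obtain c K where cK: "c > 0" "K \<ge> 0" "\<And>x s. t \<le> snd x \<Longrightarrow> gauss x s \<le> K * exp (- (c * norm s))"
    by (rule gauss_bound[OF t]) (rule that)
  have [measurable]: "\<phi> \<in> borel_measurable borel"
    by (rule borel_measurable_continuous_onI[OF test_function_continuous[OF \<phi>]])
  have int: "integrable lborel (\<lambda>p. mode (p, t) s * \<phi> p)"
  proof (rule Bochner_Integration.integrable_bound)
    show "integrable lborel (\<lambda>p. K * norm (\<phi> p))" using test_function_integrable[OF \<phi>] by simp
    have le: "norm (mode (p, t) s * \<phi> p) \<le> K * norm (\<phi> p)" for p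
    proof -
      have "gauss (p, t) s \<le> K * exp (- (c * norm s))" by (rule cK(3)) simp
      also have "\<dots> \<le> K * 1" using cK by (intro mult_left_mono) auto
      finally show ?thesis by (simp add: norm_mult norm_mode mult_right_mono)
    qed
    show "AE p in lborel. norm (mode (p, t) s * \<phi> p) \<le> norm (K * norm (\<phi> p))"
      by (intro AE_I2 order_trans[OF le]) simp
  qed measurable
  have "mode_pairing \<phi> t s = (\<integral>y. (\<integral>w. mode ((y, w), t) s * \<phi> (y, w) \<partial>lborel) \<partial>lborel)"
    unfolding mode_pairing_def using lborel_pair.integral_fst'[of "\<lambda>p. mode (p, t) s * \<phi> p"] int
    by (simp add: lborel_prod)
  also have "(\<lambda>y. \<integral>w. mode ((y, w), t) s * \<phi> (y, w) \<partial>lborel) =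
      (\<lambda>y. of_real (gauss ((y, 0), t) s) * partial_fourier \<phi> y s)"
  proof
    fix y
    have "mode ((y, w), t) s * \<phi> (y, w) = of_real (gauss ((y, 0), t) s) * (iexp (s \<bullet> w) * \<phi> (y, w))" for w
      by (simp add: mode_def gauss_def block_def)
    then show "(\<integral>w. mode ((y, w), t) s * \<phi> (y, w) \<partial>lborel) =
        of_real (gauss ((y, 0), t) s) * partial_fourier \<phi> y s"
      by (simp only: partial_fourier_def integral_mult_right_zero)
  qed
  also have "(\<integral>y. of_real (gauss ((y, 0), t) s) * partial_fourier \<phi> y s \<partial>lborel) =
      \<bar>sqrt t\<bar> ^ DIM(real^4^'n) *\<^sub>R
        (\<integral>u. of_real (gauss ((sqrt t *\<^sub>R u, 0), t) s) * partial_fourier \<phi> (sqrt t *\<^sub>R u) s \<partial>lborel)"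
    using t by (subst lborel_integral_scale[of "sqrt t"]) auto
  also have "\<bar>sqrt t\<bar> ^ DIM(real^4^'n) = t ^ (2 * CARD('n))"
  proof -
    have "DIM(real^4^'n) = 2 * (2 * CARD('n))" by simp
    then show ?thesis using t by (simp only: power_mult) simp
  qed
  also have "t ^ (2 * CARD('n)) *\<^sub>R
        (\<integral>u. of_real (gauss ((sqrt t *\<^sub>R u, 0), t) s) * partial_fourier \<phi> (sqrt t *\<^sub>R u) s \<partial>lborel) =
      (\<integral>u. of_real (t ^ (2 * CARD('n))) * (of_real (gauss ((sqrt t *\<^sub>R u, 0), t) s) * partial_fourier \<phi> (sqrt t *\<^sub>R u) s) \<partial>lborel)"
    by (simp only: integral_mult_right_zero scaleR_conv_of_real)
  also have "\<dots> = (\<integral>u. of_real (scaled_gauss t u s) * partial_fourier \<phi> (sqrt t *\<^sub>R u) s \<partial>lborel)"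
    unfolding mult.assoc[symmetric] of_real_mult[symmetric] gauss_eq_scaled[OF t] ..
  finally show ?thesis .
qed

text \<open>
  Dominated convergence is used twice, over the scaled variable \<open>u\<close> at a fixed nonzero frequency and
  then over the frequencies; \<open>exp (- |u|\<^sup>2 / 4)\<close> times the decaying weight of the partial Fourier
  transform dominates the first integrand, and its integral over \<open>u\<close> dominates the second.
\<close>

lemma kernel_initial_value:
  assumes \<phi>: "test_function \<phi>"
  shows "((\<lambda>t. \<integral>p. kernel p t * \<phi> p \<partial>lborel) \<longlongrightarrow> \<phi> (0, 0)) (at_right 0)"
proof -
  define C where "C = complex_of_real (1 / ((2 * pi) ^ 3 * (4 * pi) ^ (2 * CARD('n))))"
  define G where "G = (4 * pi) ^ (2 * CARD('n))"
  obtain K where K: "K \<ge> 0" "\<And>y s. norm (partial_fourier \<phi> y s) \<le> K * cauchy_weight s"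
    by (rule partial_fourier_decay[OF \<phi>]) (rule that)
  have gI: "integrable lborel (\<lambda>u::real^4^'n. exp (- (1/4) * (norm u)\<^sup>2))"
    by (rule integral_exp_norm_sq(1)) simp
  have gG: "(\<integral>u. exp (- (1/4) * (norm (u::real^4^'n))\<^sup>2) \<partial>lborel) = G"
  proof -
    have "DIM(real^4^'n) = 2 * (2 * CARD('n))" by simp
    then have "sqrt (pi / (1/4)) ^ DIM(real^4^'n) = G"
      by (simp only: power_mult G_def) simp
    then show ?thesis using integral_exp_norm_sq(2)[of "1/4", where 'a="real^4^'n"] by simp
  qed
  have pos: "\<forall>\<^sub>F t in at_right 0. (t::real) > 0" by (simp add: eventually_at_right_less)
  have pf_meas: "(\<lambda>u. partial_fourier \<phi> (r *\<^sub>R u) s) \<in> borel_measurable borel" for r s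
    by (intro borel_measurable_continuous_onI continuous_on_compose2[OF partial_fourier_continuous[OF \<phi>]]
        continuous_intros subset_UNIV)
  have sg_meas: "(\<lambda>u. scaled_gauss t u s) \<in> borel_measurable borel" for t s
    unfolding scaled_gauss_def by (intro borel_measurable_continuous_onI continuous_intros) simp
  have bound: "norm (of_real (scaled_gauss t u s) * partial_fourier \<phi> (sqrt t *\<^sub>R u) s)
      \<le> exp (- (1/4) * (norm u)\<^sup>2) * (K * cauchy_weight s)" if "t > 0" "s \<noteq> 0" for t u s
    unfolding norm_mult norm_of_real abs_of_nonneg[OF scaled_gauss_nonneg]
    by (intro mult_mono scaled_gauss_le that K) (auto simp: scaled_gauss_nonneg)
  have ae: "AE s in lborel. s \<noteq> (0::real^3)" by (rule AE_lborel_singleton)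
  have inner: "((\<lambda>t. mode_pairing \<phi> t s) \<longlongrightarrow> of_real G * partial_fourier \<phi> 0 s) (at_right 0)"
    if s: "s \<noteq> 0" for s
  proof -
    have "((\<lambda>t. \<integral>u. of_real (scaled_gauss t u s) * partial_fourier \<phi> (sqrt t *\<^sub>R u) s \<partial>lborel) \<longlongrightarrow>
        (\<integral>u. of_real (exp (- (1/4) * (norm (u::real^4^'n))\<^sup>2)) * partial_fourier \<phi> 0 s \<partial>lborel)) (at_right 0)"
    proof (rule dominated_convergence_filter)
      show "integrable lborel (\<lambda>u::real^4^'n. exp (- (1/4) * (norm u)\<^sup>2) * (K * cauchy_weight s))"
        using gI by (rule integrable_mult_left)
      show "\<forall>\<^sub>F t in at_right 0. AE u in lborel. norm (of_real (scaled_gauss t u s) * partial_fourier \<phi> (sqrt t *\<^sub>R u) s)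
          \<le> exp (- (1/4) * (norm u)\<^sup>2) * (K * cauchy_weight s)"
        using pos by eventually_elim (intro AE_I2 bound s)
      show "AE u in lborel. ((\<lambda>t. of_real (scaled_gauss t u s) * partial_fourier \<phi> (sqrt t *\<^sub>R u) s) \<longlongrightarrow>
          of_real (exp (- (1/4) * (norm u)\<^sup>2)) * partial_fourier \<phi> 0 s) (at_right 0)"
      proof (intro AE_I2 tendsto_mult tendsto_of_real scaled_gauss_tendsto s)
        fix u :: "real^4^'n"
        have "((\<lambda>t. sqrt t *\<^sub>R u) \<longlongrightarrow> sqrt 0 *\<^sub>R u) (at_right 0)" by (intro tendsto_intros)
        then have "((\<lambda>t. sqrt t *\<^sub>R u) \<longlongrightarrow> 0) (at_right 0)" by simp
        moreover have "isCont (\<lambda>y. partial_fourier \<phi> y s) 0"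
          using partial_fourier_continuous[OF \<phi>] by (simp add: continuous_on_eq_continuous_at)
        ultimately show "((\<lambda>t. partial_fourier \<phi> (sqrt t *\<^sub>R u) s) \<longlongrightarrow> partial_fourier \<phi> 0 s) (at_right 0)"
          by (rule isCont_tendsto_compose[rotated])
      qed
      show "\<forall>\<^sub>F t in at_right 0. (\<lambda>u. of_real (scaled_gauss t u s) * partial_fourier \<phi> (sqrt t *\<^sub>R u) s) \<in> borel_measurable lborel"
        using pf_meas sg_meas by (intro always_eventually allI) simp
    qed measurable
    also have "(\<integral>u. of_real (exp (- (1/4) * (norm (u::real^4^'n))\<^sup>2)) * partial_fourier \<phi> 0 s \<partial>lborel) =
        of_real G * partial_fourier \<phi> 0 s"
      unfolding integral_mult_left_zero integral_complex_of_real gG ..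
    finally show ?thesis
      by (rule Lim_transform_eventually) (use pos in eventually_elim, simp add: mode_pairing_scaled[OF \<phi>])
  qed
  have pf0: "partial_fourier \<phi> 0 \<in> borel_measurable borel"
  proof -
    have [measurable]: "(\<lambda>w. \<phi> (0, w)) \<in> borel_measurable borel" by (rule slice_measurable(1)[OF \<phi>])
    have "(\<lambda>(s, w). iexp (s \<bullet> w) * \<phi> (0, w)) \<in> borel_measurable (borel \<Otimes>\<^sub>M lborel)" by measurable
    from lborel.borel_measurable_lebesgue_integral[OF this] show ?thesis
      by (simp add: partial_fourier_def[abs_def])
  qed
  have "((\<lambda>t. integral\<^sup>L lborel (mode_pairing \<phi> t)) \<longlongrightarrow>
      (\<integral>s. of_real G * partial_fourier \<phi> 0 s \<partial>lborel)) (at_right 0)"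
  proof (rule dominated_convergence_filter)
    show "integrable lborel (\<lambda>s::real^3. G * (K * cauchy_weight s))"
      by (intro integrable_mult_right integrable_cauchy_weight)
    show "\<forall>\<^sub>F t in at_right 0. AE s in lborel. norm (mode_pairing \<phi> t s) \<le> G * (K * cauchy_weight s)"
      using pos
    proof eventually_elim
      case (elim t)
      show ?case using ae
      proof eventually_elim
        case (elim s)
        have "norm (mode_pairing \<phi> t s) \<le> (\<integral>u. exp (- (1/4) * (norm (u::real^4^'n))\<^sup>2) * (K * cauchy_weight s) \<partial>lborel)"
          unfolding mode_pairing_scaled[OF \<phi> \<open>t > 0\<close>]
        proof (rule Bochner_Integration.integral_norm_bound_integral)
          show i: "integrable lborel (\<lambda>u::real^4^'n. exp (- (1/4) * (norm u)\<^sup>2) * (K * cauchy_weight s))"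
            using gI by (rule integrable_mult_left)
          show "integrable lborel (\<lambda>u. of_real (scaled_gauss t u s) * partial_fourier \<phi> (sqrt t *\<^sub>R u) s)"
          proof (rule Bochner_Integration.integrable_bound[OF i])
            show "AE u in lborel. norm (of_real (scaled_gauss t u s) * partial_fourier \<phi> (sqrt t *\<^sub>R u) s)
                \<le> norm (exp (- (1/4) * (norm u)\<^sup>2) * (K * cauchy_weight s))"
              unfolding real_norm_def by (intro AE_I2 order_trans[OF bound[OF \<open>t > 0\<close> elim] abs_ge_self])
          qed (use pf_meas sg_meas in simp)
        qed (rule bound[OF \<open>t > 0\<close> elim])
        then show ?case by (simp only: integral_mult_left_zero gG)
      qed
    qed
    show "\<forall>\<^sub>F t in at_right 0. mode_pairing \<phi> t \<in> borel_measurable lborel"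
      using pos by eventually_elim (rule kernel_pairing(2)[OF \<phi>])
    show "AE s in lborel. ((\<lambda>t. mode_pairing \<phi> t s) \<longlongrightarrow> of_real G * partial_fourier \<phi> 0 s) (at_right 0)"
      using ae by eventually_elim (rule inner)
  qed (use pf0 in simp)
  also have "(\<integral>s. of_real G * partial_fourier \<phi> 0 s \<partial>lborel) = of_real G * (of_real ((2 * pi) ^ 3) * \<phi> (0, 0))"
  proof -
    obtain M R where MR: "M > 0" "R > 0" "\<And>y w. norm (\<phi> (y, w)) \<le> M * indicator (cball 0 R) w"
      by (rule test_function_slice_bound[OF \<phi>]) (rule that)
    have "(\<integral>s. (\<integral>w. iexp (s \<bullet> w) * \<phi> (0, w) \<partial>lborel) \<partial>lborel) = of_real ((2 * pi) ^ DIM(real^3)) * \<phi> (0, 0)"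
    proof (rule fourier_inversion_at_0)
      show "integrable lborel (\<lambda>w. \<phi> (0, w))" by (rule integrable_slice(1)[OF \<phi>])
      have "continuous_on UNIV (\<lambda>w. \<phi> (0, w))"
        by (intro continuous_on_compose2[OF test_function_continuous[OF \<phi>]] continuous_intros subset_UNIV)
      then show "isCont (\<lambda>w. \<phi> (0, w)) 0" by (simp add: continuous_on_eq_continuous_at)
      show "norm (\<phi> (0, w)) \<le> M" for w
        using MR(1) by (intro order_trans[OF MR(3)]) (simp add: indicator_def)
      show "integrable lborel (\<lambda>s. \<integral>w. iexp (s \<bullet> w) * \<phi> (0, w) \<partial>lborel)"
        unfolding partial_fourier_def[symmetric]
      proof (rule Bochner_Integration.integrable_bound)
        show "integrable lborel (\<lambda>s::real^3. K * cauchy_weight s)"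
          by (intro integrable_mult_right integrable_cauchy_weight)
        show "AE s in lborel. norm (partial_fourier \<phi> 0 s) \<le> norm (K * cauchy_weight s)"
          using K(2) by (auto intro: order_trans[OF _ abs_ge_self])
      qed (use pf0 in simp)
    qed
    then show ?thesis by (simp only: integral_mult_right_zero partial_fourier_def) simp
  qed
  finally have "((\<lambda>t. C * integral\<^sup>L lborel (mode_pairing \<phi> t)) \<longlongrightarrow>
      C * (of_real G * (of_real ((2 * pi) ^ 3) * \<phi> (0, 0)))) (at_right 0)"
    by (rule tendsto_mult_left)
  moreover have "C * (of_real G * (of_real ((2 * pi) ^ 3) * \<phi> (0, 0))) = \<phi> (0, 0)"
    by (simp add: C_def G_def)
  ultimately have "((\<lambda>t. C * integral\<^sup>L lborel (mode_pairing \<phi> t)) \<longlongrightarrow> \<phi> (0, 0)) (at_right 0)" by (simp only:)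
  then show ?thesis
    by (rule Lim_transform_eventually)
      (use pos in eventually_elim, simp only: kernel_pairing(1)[OF \<phi>] C_def)
qed

section \<open>The integral formula\<close>

lemma kernel_heat_kernel: "heat_kernel a kernel"
  unfolding heat_kernel_def
proof (intro conjI allI impI)
  let ?C = "complex_of_real (1 / ((2 * pi) ^ 3 * (4 * pi) ^ (2 * CARD('n))))"
  have *: "(\<lambda>(p, t). kernel p t) = (\<lambda>x. (\<integral>s. mode x s \<partial>lborel) * ?C)"
    by (auto simp: kernel_def)
  show "Ck_on 2 (\<lambda>(p, t). kernel p t) (UNIV \<times> {0<..})"
    unfolding * upper_def[symmetric] by (rule Ck_on_mult_const[OF open_upper Ck_on_integral_mode])
  show "sublaplacian a (\<lambda>q. kernel q t) p - vector_derivative (kernel p) (at t) = 0" if "t > 0" for p t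
    using kernel_heat_equation[OF that] by simp
  show "((\<lambda>t. LINT p|lborel. kernel p t * \<phi> p) \<longlongrightarrow> \<phi> (0, 0)) (at_right 0)" if "test_function \<phi>" for \<phi>
    by (rule kernel_initial_value[OF that])
qed

text \<open>
  The substitution \<open>\<tau> = t s\<close> is compatible with the weights because \<open>|t s|\<^sub>l = t |s|\<^sub>l\<close>. At \<open>s = 0\<close> the two
  sides differ, since the conventions for \<open>s coth s\<close> and \<open>s / sinh s\<close> at \<open>0\<close> are not those of \<open>rate\<close>
  and \<open>amp\<close>.
\<close>

lemma phase_scaled:
  assumes t: "t > 0" and s: "s \<noteq> 0"
  shows "exp (- phase a y w (t *\<^sub>R s) / of_real t) * of_real (volume_factor a (t *\<^sub>R s)) =
    of_real (t ^ (2 * CARD('n))) * mode ((y, w), t) s"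
proof -
  have r: "lam l s \<noteq> 0" for l using lam_pos[OF s, of l] by simp
  have sc: "s_coth (lam l (t *\<^sub>R s)) = t * rate (lam l s) t" "s_over_sinh (lam l (t *\<^sub>R s)) = t * amp (lam l s) t" for l
    using t r[of l] by (simp_all add: lam_scaleR s_coth_def s_over_sinh_def rate_def amp_def mult_ac)
  have w: "(\<Sum>m\<in>UNIV. (t *\<^sub>R s) $ m * w $ m) = t * (s \<bullet> w)"
    by (simp add: inner_vec_def sum_distrib_left mult.assoc)
  have rt: "(\<Sum>l\<in>UNIV. (norm (y $ l))\<^sup>2 / 4 * s_coth (lam l (t *\<^sub>R s))) =
      t * (\<Sum>l\<in>UNIV. (norm (y $ l))\<^sup>2 / 4 * rate (lam l s) t)"
    unfolding sc sum_distrib_left by (intro sum.cong) auto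
  have "- phase a y w (t *\<^sub>R s) / of_real t =
      \<i> * of_real (s \<bullet> w) + of_real (- (\<Sum>l\<in>UNIV. (norm (y $ l))\<^sup>2 / 4 * rate (lam l s) t))"
    unfolding phase_def w rt of_real_mult using t
    by (simp add: add_divide_distrib diff_divide_distrib)
  then have "exp (- phase a y w (t *\<^sub>R s) / of_real t) =
      iexp (s \<bullet> w) * of_real (\<Prod>l\<in>UNIV. exp (- ((norm (y $ l))\<^sup>2 / 4 * rate (lam l s) t)))"
    by (simp only: exp_add exp_of_real sum_negf[symmetric] exp_sum[OF finite])
  moreover have "volume_factor a (t *\<^sub>R s) = t ^ (2 * CARD('n)) * (\<Prod>l\<in>UNIV. (amp (lam l s) t)\<^sup>2)"
    unfolding volume_factor_def sc(2) by (simp add: power_mult_distrib prod.distrib power_mult)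
  ultimately show ?thesis
    by (simp add: mode_def gauss_def block_def prod.distrib mult_ac)
qed

lemma kernel_formula:
  assumes t: "t > 0"
  shows "integrable lborel (\<lambda>\<tau>. exp (- phase a y w \<tau> / of_real t) * of_real (volume_factor a \<tau>))" (is "integrable lborel ?E")
    and "kernel (y, w) t = of_real (1 / ((2 * pi) ^ 3 * (4 * pi) ^ (2 * CARD('n))) / t ^ (2 * CARD('n) + 3)) *
      (LINT \<tau>|lborel. exp (- phase a y w \<tau> / of_real t) * of_real (volume_factor a \<tau>))"
proof -
  define C where "C = complex_of_real (1 / ((2 * pi) ^ 3 * (4 * pi) ^ (2 * CARD('n))))"
  have up: "((y, w), t) \<in> upper" using t by (simp add: upper_iff)
  have int: "integrable lborel (\<lambda>s. mode ((y, w), t) s)"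
    using integrable_mode[OF moderate_const[of _ 1] up] by simp
  \<comment> \<open>away from the origin the integrand is a mode, which gives its measurability; the origin is a null set\<close>
  have E: "?E (t *\<^sub>R s) = (if s = 0 then ?E 0 else of_real (t ^ (2 * CARD('n))) * mode ((y, w), t) s)" for s
    using phase_scaled[OF t] by auto
  have m: "(\<lambda>s. ?E (t *\<^sub>R s)) \<in> borel_measurable lborel" unfolding E by measurable
  have ae: "AE s in lborel. ?E (t *\<^sub>R s) = of_real (t ^ (2 * CARD('n))) * mode ((y, w), t) s"
    using AE_lborel_singleton[of "0::real^3"] by eventually_elim (rule phase_scaled[OF t])
  have mm: "(\<lambda>s. of_real (t ^ (2 * CARD('n))) * mode ((y, w), t) s) \<in> borel_measurable lborel" by measurable
  have "integrable lborel (\<lambda>s. ?E (t *\<^sub>R s))"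
    using integrable_cong_AE[OF m mm ae] int by simp
  then show "integrable lborel ?E"
    using lborel_integrable_scale_iff[of t ?E] t by simp
  have "integral\<^sup>L lborel ?E = \<bar>t\<bar> ^ DIM(real^3) *\<^sub>R (\<integral>s. ?E (t *\<^sub>R s) \<partial>lborel)"
    using t by (intro lborel_integral_scale) simp
  also have "(\<integral>s. ?E (t *\<^sub>R s) \<partial>lborel) = of_real (t ^ (2 * CARD('n))) * integral\<^sup>L lborel (mode ((y, w), t))"
    unfolding integral_cong_AE[OF m mm ae] by (rule integral_mult_right_zero)
  finally have "integral\<^sup>L lborel ?E = of_real (t ^ (2 * CARD('n) + 3)) * integral\<^sup>L lborel (mode ((y, w), t))"
    using t by (simp add: scaleR_conv_of_real power_add)
  moreover have "kernel (y, w) t = C * integral\<^sup>L lborel (mode ((y, w), t))"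
    unfolding kernel_def C_def by (simp only: integral_mult_left_zero mult.commute)
  ultimately show "kernel (y, w) t = of_real (1 / ((2 * pi) ^ 3 * (4 * pi) ^ (2 * CARD('n))) / t ^ (2 * CARD('n) + 3)) * integral\<^sup>L lborel ?E"
    using t by (simp add: C_def)
qed

end

theorem theorem7p1:
  fixes a :: "3 \<Rightarrow> 'n::finite \<Rightarrow> real"
  assumes "\<And>m l. a m l > 0"
  shows "\<exists>(C::real) P. heat_kernel a P \<and>
    (\<forall>y w. \<forall>t>0.
       integrable lborel (\<lambda>\<tau>. exp (- phase a y w \<tau> / of_real t) * of_real (volume_factor a \<tau>)) \<and>
       P (y, w) t =
         of_real (C / t ^ (2 * CARD('n) + 3)) *
         (LINT \<tau>|lborel. exp (- phase a y w \<tau> / of_real t) * of_real (volume_factor a \<tau>)))"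
proof -
  interpret quaternionic_laplacian a by standard (rule assms)
  show ?thesis
    by (intro exI[of _ "1 / ((2 * pi) ^ 3 * (4 * pi) ^ (2 * CARD('n)))"] exI[of _ kernel] conjI allI impI
        kernel_heat_kernel kernel_formula)
qed

end
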